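(* Let $p$ be a prime and $\mathcal{D}=D_{p,\infty}$. There is no reducible maximal finite subgroup of $GL_3(\mathcal{D})$ that is conjugate to a block diagonal group $\mathrm{Diag}(G_1,G_2,G_3)$ with $G_1,G_2,G_3$ irreducible maximal finite subgroups of $\mathcal{D}^\times$.
   Context: $D_{p,\infty}$ is the quaternion algebra over $\mathbb{Q}$ ramified exactly at $p$ and $\infty$. A finite subgroup $G$ of $GL_n(\mathcal{D})$ is irreducible if its centralizer $C_{M_n(\mathcal{D})}(G)$ is a division algebra, reducible otherwise. *)

theory Defs
  imports "HOL-Algebra.Algebra" "HOL-Algebra.Algebraic_Closure_Type"
begin

section \<open>Quaternion algebras\<close>

text \<open>
  The algebra \<open>(a, b)\<^sub>F\<close> with \<open>F\<close>-basis \<open>1, i, j, k = i j\<close> and relations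
  \<open>i i = a\<close>, \<open>j j = b\<close>, \<open>j i = - i j\<close>; a quadruple lists the coordinates
  in this order. It is a quaternion algebra for a field \<open>F\<close> of characteristic other
  than 2 and nonzero \<open>a, b\<close>.
\<close>

definition quaternion_ring ::
  "('f, 'm) ring_scheme \<Rightarrow> 'f \<Rightarrow> 'f \<Rightarrow> ('f \<times> 'f \<times> 'f \<times> 'f) ring"
  where "quaternion_ring F a b = \<lparr>
    carrier = carrier F \<times> carrier F \<times> carrier F \<times> carrier F,
    monoid.mult = (\<lambda>(x0, x1, x2, x3) (y0, y1, y2, y3).
      ((x0 \<otimes>\<^bsub>F\<^esub> y0 \<oplus>\<^bsub>F\<^esub> a \<otimes>\<^bsub>F\<^esub> (x1 \<otimes>\<^bsub>F\<^esub> y1) \<oplus>\<^bsub>F\<^esub> b \<otimes>\<^bsub>F\<^esub> (x2 \<otimes>\<^bsub>F\<^esub> y2))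
         \<ominus>\<^bsub>F\<^esub> (a \<otimes>\<^bsub>F\<^esub> b) \<otimes>\<^bsub>F\<^esub> (x3 \<otimes>\<^bsub>F\<^esub> y3),
       (x0 \<otimes>\<^bsub>F\<^esub> y1 \<oplus>\<^bsub>F\<^esub> x1 \<otimes>\<^bsub>F\<^esub> y0 \<oplus>\<^bsub>F\<^esub> b \<otimes>\<^bsub>F\<^esub> (x3 \<otimes>\<^bsub>F\<^esub> y2))
         \<ominus>\<^bsub>F\<^esub> b \<otimes>\<^bsub>F\<^esub> (x2 \<otimes>\<^bsub>F\<^esub> y3),
       (x0 \<otimes>\<^bsub>F\<^esub> y2 \<oplus>\<^bsub>F\<^esub> x2 \<otimes>\<^bsub>F\<^esub> y0 \<oplus>\<^bsub>F\<^esub> a \<otimes>\<^bsub>F\<^esub> (x1 \<otimes>\<^bsub>F\<^esub> y3))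
         \<ominus>\<^bsub>F\<^esub> a \<otimes>\<^bsub>F\<^esub> (x3 \<otimes>\<^bsub>F\<^esub> y1),
       (x0 \<otimes>\<^bsub>F\<^esub> y3 \<oplus>\<^bsub>F\<^esub> x3 \<otimes>\<^bsub>F\<^esub> y0 \<oplus>\<^bsub>F\<^esub> x1 \<otimes>\<^bsub>F\<^esub> y2)
         \<ominus>\<^bsub>F\<^esub> x2 \<otimes>\<^bsub>F\<^esub> y1)),
    one = (\<one>\<^bsub>F\<^esub>, \<zero>\<^bsub>F\<^esub>, \<zero>\<^bsub>F\<^esub>, \<zero>\<^bsub>F\<^esub>),
    ring.zero = (\<zero>\<^bsub>F\<^esub>, \<zero>\<^bsub>F\<^esub>, \<zero>\<^bsub>F\<^esub>, \<zero>\<^bsub>F\<^esub>),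
    add = (\<lambda>(x0, x1, x2, x3) (y0, y1, y2, y3).
      (x0 \<oplus>\<^bsub>F\<^esub> y0, x1 \<oplus>\<^bsub>F\<^esub> y1, x2 \<oplus>\<^bsub>F\<^esub> y2, x3 \<oplus>\<^bsub>F\<^esub> y3)) \<rparr>"

abbreviation rat_ring :: "rat ring"
  where "rat_ring \<equiv> ring_of_type_algebra"

text \<open>
  A ring isomorphism between algebras over the rationals is automatically linear over
  the rationals, so it is enough to speak of rings here.
\<close>

definition rat_quaternion_symbol :: "('d, 'm) ring_scheme \<Rightarrow> rat \<Rightarrow> rat \<Rightarrow> bool"
  where "rat_quaternion_symbol D a b \<longleftrightarrow>
    a \<noteq> 0 \<and> b \<noteq> 0 \<and> D \<simeq> quaternion_ring rat_ring a b"

definition rat_quaternion_algebra :: "('d, 'm) ring_scheme \<Rightarrow> bool"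
  where "rat_quaternion_algebra D \<longleftrightarrow> ring D \<and> (\<exists>a b. rat_quaternion_symbol D a b)"

definition is_division_algebra :: "('a, 'm) ring_scheme \<Rightarrow> bool"
  where "is_division_algebra R \<longleftrightarrow>
    ring R \<and> \<one>\<^bsub>R\<^esub> \<noteq> \<zero>\<^bsub>R\<^esub> \<and> Units R = carrier R - {\<zero>\<^bsub>R\<^esub>}"


section \<open>Completions of the rational numbers\<close>

text \<open>
  The completion of the rationals with respect to an absolute value \<open>v\<close>: Cauchy
  sequences modulo null sequences.
\<close>

definition cauchy_seq :: "(rat \<Rightarrow> real) \<Rightarrow> (nat \<Rightarrow> rat) \<Rightarrow> bool"
  where "cauchy_seq v x \<longleftrightarrow> (\<forall>e>0. \<exists>N. \<forall>m\<ge>N. \<forall>n\<ge>N. v (x m - x n) < e)"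

definition cauchy_seq_ring :: "(rat \<Rightarrow> real) \<Rightarrow> (nat \<Rightarrow> rat) ring"
  where "cauchy_seq_ring v = \<lparr>
    carrier = {x. cauchy_seq v x},
    monoid.mult = (\<lambda>x y n. x n * y n),
    one = (\<lambda>_. 1),
    ring.zero = (\<lambda>_. 0),
    add = (\<lambda>x y n. x n + y n) \<rparr>"

definition null_seqs :: "(rat \<Rightarrow> real) \<Rightarrow> (nat \<Rightarrow> rat) set"
  where "null_seqs v = {x. (\<lambda>n. v (x n)) \<longlonglongrightarrow> 0}"

definition completion :: "(rat \<Rightarrow> real) \<Rightarrow> (nat \<Rightarrow> rat) set ring"
  where "completion v = cauchy_seq_ring v Quot null_seqs v"

definition completion_embed :: "(rat \<Rightarrow> real) \<Rightarrow> rat \<Rightarrow> (nat \<Rightarrow> rat) set"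
  where "completion_embed v q = null_seqs v +>\<^bsub>cauchy_seq_ring v\<^esub> (\<lambda>_. q)"

definition abs_infinity :: "rat \<Rightarrow> real"
  where "abs_infinity x = real_of_rat \<bar>x\<bar>"

definition abs_padic :: "nat \<Rightarrow> rat \<Rightarrow> real"
  where "abs_padic q x = (if x = 0 then 0 else
    real q powi (int (multiplicity (int q) (snd (quotient_of x)))
               - int (multiplicity (int q) (fst (quotient_of x)))))"

text \<open>
  Extending scalars from the rationals to the completion \<open>K\<close> at \<open>v\<close> turns
  \<open>(a, b)\<close> over the rationals into \<open>(a, b)\<close> over \<open>K\<close>. The choice of
  \<open>a, b\<close> is immaterial, because the scalar extension depends only on \<open>D\<close>.
\<close>

definition ramified_at :: "(rat \<Rightarrow> real) \<Rightarrow> ('d, 'm) ring_scheme \<Rightarrow> bool"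
  where "ramified_at v D \<longleftrightarrow> (\<exists>a b. rat_quaternion_symbol D a b \<and>
    is_division_algebra
      (quaternion_ring (completion v) (completion_embed v a) (completion_embed v b)))"

text \<open>\<open>D\<close> is (a copy of) the algebra \<open>D\<^bsub>p,\<infinity>\<^esub>\<close>.\<close>

definition is_D_p_infinity :: "nat \<Rightarrow> ('d, 'm) ring_scheme \<Rightarrow> bool"
  where "is_D_p_infinity p D \<longleftrightarrow>
    rat_quaternion_algebra D \<and>
    ramified_at abs_infinity D \<and>
    (\<forall>q::nat. Factorial_Ring.prime q \<longrightarrow> (ramified_at (abs_padic q) D \<longleftrightarrow> q = p))"


section \<open>Matrix groups\<close>

text \<open>
  HOL-Algebra has no matrices over a ring given by a carrier; here they are extensional
  functions on pairs of indices below \<open>n\<close>.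
\<close>

definition matrix_ring :: "nat \<Rightarrow> ('d, 'm) ring_scheme \<Rightarrow> (nat \<times> nat \<Rightarrow> 'd) ring"
  where "matrix_ring n D = \<lparr>
    carrier = {..<n} \<times> {..<n} \<rightarrow>\<^sub>E carrier D,
    monoid.mult = (\<lambda>A B. \<lambda>(i, k)\<in>{..<n} \<times> {..<n}.
      \<Oplus>\<^bsub>D\<^esub>j\<in>{..<n}. A (i, j) \<otimes>\<^bsub>D\<^esub> B (j, k)),
    one = (\<lambda>(i, k)\<in>{..<n} \<times> {..<n}. if i = k then \<one>\<^bsub>D\<^esub> else \<zero>\<^bsub>D\<^esub>),
    ring.zero = (\<lambda>_\<in>{..<n} \<times> {..<n}. \<zero>\<^bsub>D\<^esub>),
    add = (\<lambda>A B. \<lambda>ik\<in>{..<n} \<times> {..<n}. A ik \<oplus>\<^bsub>D\<^esub> B ik) \<rparr>"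

definition GL :: "nat \<Rightarrow> ('d, 'm) ring_scheme \<Rightarrow> (nat \<times> nat \<Rightarrow> 'd) monoid"
  where "GL n D = units_of (matrix_ring n D)"

definition diag_matrix :: "('d, 'm) ring_scheme \<Rightarrow> 'd list \<Rightarrow> nat \<times> nat \<Rightarrow> 'd"
  where "diag_matrix D ds = (\<lambda>(i, k)\<in>{..<length ds} \<times> {..<length ds}.
    if i = k then ds ! i else \<zero>\<^bsub>D\<^esub>)"

definition Diag :: "('d, 'm) ring_scheme \<Rightarrow> 'd set \<Rightarrow> 'd set \<Rightarrow> 'd set \<Rightarrow> (nat \<times> nat \<Rightarrow> 'd) set"
  where "Diag D G1 G2 G3 =
    {diag_matrix D [g1, g2, g3] | g1 g2 g3. g1 \<in> G1 \<and> g2 \<in> G2 \<and> g3 \<in> G3}"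


section \<open>Finite subgroups\<close>

definition maximal_finite_subgroup :: "'a set \<Rightarrow> ('a, 'm) monoid_scheme \<Rightarrow> bool"
  where "maximal_finite_subgroup G \<Gamma> \<longleftrightarrow>
    subgroup G \<Gamma> \<and> finite G \<and>
    (\<forall>H. subgroup H \<Gamma> \<and> finite H \<and> G \<subseteq> H \<longrightarrow> H = G)"

definition conjugate_subgroups :: "('a, 'm) monoid_scheme \<Rightarrow> 'a set \<Rightarrow> 'a set \<Rightarrow> bool"
  where "conjugate_subgroups \<Gamma> G H \<longleftrightarrow>
    (\<exists>x\<in>carrier \<Gamma>. H = x <#\<^bsub>\<Gamma>\<^esub> (G #>\<^bsub>\<Gamma>\<^esub> inv\<^bsub>\<Gamma>\<^esub> x))"

definition centralizer_ring :: "('a, 'm) ring_scheme \<Rightarrow> 'a set \<Rightarrow> ('a, 'm) ring_scheme"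
  where "centralizer_ring R G =
    R\<lparr>carrier := {x \<in> carrier R. \<forall>g\<in>G. x \<otimes>\<^bsub>R\<^esub> g = g \<otimes>\<^bsub>R\<^esub> x}\<rparr>"

text \<open>
  For a finite subgroup \<open>G\<close> of the units of \<open>R\<close>, where \<open>R\<close> is a matrix ring over
  \<open>D\<close>, or \<open>D\<close> itself in place of the one-by-one matrices.
\<close>

definition irreducible_in :: "('a, 'm) ring_scheme \<Rightarrow> 'a set \<Rightarrow> bool"
  where "irreducible_in R G \<longleftrightarrow> is_division_algebra (centralizer_ring R G)"

abbreviation reducible_in :: "('a, 'm) ring_scheme \<Rightarrow> 'a set \<Rightarrow> bool"
  where "reducible_in R G \<equiv> \<not> irreducible_in R G"

end

(*
  Ramification at infinity forces D = (a, b) with a, b < 0, so D is a subalgebra of the real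
  quaternions with rational real parts. In a finite subgroup all norms are 1 and all traces are
  integers of absolute value at most 2. Hence a maximal finite subgroup is {1, -1}, or contains a
  square root of -1, or contains a primitive cube root of unity. Any two maximal finite subgroups
  that share one of these properties are conjugate: first make them share the root (Skolem-Noether),
  then look at how a further element sits relative to it. So among three maximal finite subgroups of
  the unit group two are conjugate, and a monomial matrix swapping the two corresponding blocks
  enlarges the block diagonal group.
*)

theory Submission
  imports Defs
begin

section \<open>Real quaternions\<close>

text \<open>Over the real numbers, quaternions of equal trace and norm are conjugate; here the
  conjugating element must lie in D, so Skolem-Noether is replaced by explicit elements such as a +
  b, built inside D. In the real quaternions the trace is twice the real part, and orthogonal pure
  quaternions anticommute, so the position of g relative to a root i of -1 is read off from the
  traces of g and g i, two integers with few possible values. A further element can then be of two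
  kinds, an anticommuting root of -1 or an element of order 3 orthogonal to i. No D contains both
  kinds for the same i, because 3/4 is not a sum of two rational squares. Three types and three
  groups do not by themselves force a coincidence. It is forced because -1 lies in every maximal
  finite group: if {1, -1} is maximal it is the only such group, and otherwise at most two types
  remain. The swapping matrix carries mutually inverse entries, so it is an involution and adjoining
  it merely doubles the group.\<close>

datatype quat = Quat (qre: real) (qi: real) (qj: real) (qk: real)

lemma quat_eq_iff: "x = y \<longleftrightarrow> qre x = qre y \<and> qi x = qi y \<and> qj x = qj y \<and> qk x = qk y"
  by (cases x; cases y) auto

instantiation quat :: ring_1
begin

definition "0 = Quat 0 0 0 0"
definition "1 = Quat 1 0 0 0"
definition "x + y = Quat (qre x + qre y) (qi x + qi y) (qj x + qj y) (qk x + qk y)"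
definition "x - y = Quat (qre x - qre y) (qi x - qi y) (qj x - qj y) (qk x - qk y)"
definition "- x = Quat (- qre x) (- qi x) (- qj x) (- qk x)"
definition "x * y = Quat
  (qre x * qre y - qi x * qi y - qj x * qj y - qk x * qk y)
  (qre x * qi y + qi x * qre y + qj x * qk y - qk x * qj y)
  (qre x * qj y + qj x * qre y + qk x * qi y - qi x * qk y)
  (qre x * qk y + qk x * qre y + qi x * qj y - qj x * qi y)"

instance
  by standard (simp_all add: zero_quat_def one_quat_def plus_quat_def minus_quat_def
      uminus_quat_def times_quat_def algebra_simps)

end

lemma quat_sel [simp]:
  "qre 0 = 0" "qi 0 = 0" "qj 0 = 0" "qk 0 = 0"
  "qre 1 = 1" "qi 1 = 0" "qj 1 = 0" "qk 1 = 0"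
  "qre (x + y) = qre x + qre y" "qi (x + y) = qi x + qi y"
  "qj (x + y) = qj x + qj y" "qk (x + y) = qk x + qk y"
  "qre (x - y) = qre x - qre y" "qi (x - y) = qi x - qi y"
  "qj (x - y) = qj x - qj y" "qk (x - y) = qk x - qk y"
  "qre (- x) = - qre x" "qi (- x) = - qi x" "qj (- x) = - qj x" "qk (- x) = - qk x"
  by (simp_all add: zero_quat_def one_quat_def plus_quat_def minus_quat_def uminus_quat_def)

lemma quat_mult_sel:
  "qre (x * y) = qre x * qre y - qi x * qi y - qj x * qj y - qk x * qk y"
  "qi (x * y) = qre x * qi y + qi x * qre y + qj x * qk y - qk x * qj y"
  "qj (x * y) = qre x * qj y + qj x * qre y + qk x * qi y - qi x * qk y"
  "qk (x * y) = qre x * qk y + qk x * qre y + qi x * qj y - qj x * qi y"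
  by (simp_all add: times_quat_def)

definition qnorm :: "quat \<Rightarrow> real"
  where "qnorm x = (qre x)\<^sup>2 + (qi x)\<^sup>2 + (qj x)\<^sup>2 + (qk x)\<^sup>2"

lemma qnorm_eq_0_iff [simp]: "qnorm x = 0 \<longleftrightarrow> x = 0"
proof -
  have "qnorm x = 0 \<longleftrightarrow> (qre x)\<^sup>2 + (qi x)\<^sup>2 = 0 \<and> (qj x)\<^sup>2 + (qk x)\<^sup>2 = 0"
    unfolding qnorm_def add.assoc[of _ "(qj x)\<^sup>2"]
    by (rule add_nonneg_eq_0_iff) simp_all
  then show ?thesis
    by (auto simp: quat_eq_iff sum_power2_eq_zero_iff)
qed

lemma qnorm_nonneg [simp]: "0 \<le> qnorm x"
  by (simp add: qnorm_def)

instantiation quat :: division_ring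
begin

text \<open>The conjugate divided by the norm. Division by zero yields 0, so
  \<open>inverse 0 = 0\<close> comes out as the type class requires.\<close>

definition "inverse x = (let r = 1 / qnorm x in Quat (r * qre x) (- r * qi x) (- r * qj x) (- r * qk x))"
definition "x div (y::quat) = x * inverse y"

instance
proof
  fix x :: quat
  assume "x \<noteq> 0"
  define r where "r = 1 / qnorm x"
  with \<open>x \<noteq> 0\<close> have "r * qnorm x = 1" by simp
  then have r: "r * (qre x * qre x) + r * (qi x * qi x) + r * (qj x * qj x) + r * (qk x * qk x) = 1"
    by (simp add: qnorm_def power2_eq_square algebra_simps)
  have i: "inverse x = Quat (r * qre x) (- r * qi x) (- r * qj x) (- r * qk x)"
    by (simp add: inverse_quat_def r_def)
  show "inverse x * x = 1" "x * inverse x = 1"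
    unfolding i quat_eq_iff using r by (simp_all add: quat_mult_sel algebra_simps)
next
  show "inverse (0::quat) = 0"
    by (simp add: quat_eq_iff inverse_quat_def)
qed (rule divide_quat_def)

end

lemma qnorm_mult: "qnorm (x * y) = qnorm x * qnorm y"
  by (simp add: qnorm_def quat_mult_sel power2_eq_square algebra_simps)

lemma qnorm_1 [simp]: "qnorm 1 = 1"
  by (simp add: qnorm_def)

lemma qnorm_power: "qnorm (x ^ n) = qnorm x ^ n"
  by (induction n) (simp_all add: qnorm_mult)

lemma qnorm_minus [simp]: "qnorm (- x) = qnorm x"
  by (simp add: qnorm_def)

instantiation quat :: real_algebra_1
begin

definition "scaleR r x = Quat (r * qre x) (r * qi x) (r * qj x) (r * qk x)"

instance
  by standard (simp_all add: quat_eq_iff quat_mult_sel scaleR_quat_def algebra_simps)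

end

instance quat :: real_div_algebra ..

lemma quat_scaleR_sel [simp]:
  "qre (r *\<^sub>R x) = r * qre x" "qi (r *\<^sub>R x) = r * qi x"
  "qj (r *\<^sub>R x) = r * qj x" "qk (r *\<^sub>R x) = r * qk x"
  by (simp_all add: scaleR_quat_def)

lemma quat_of_real_sel [simp]:
  "qre (of_real r) = r" "qi (of_real r) = 0" "qj (of_real r) = 0" "qk (of_real r) = 0"
  by (simp_all add: of_real_def)

lemma qre_mult_commute: "qre (x * y) = qre (y * x)"
  by (simp add: quat_mult_sel)

text \<open>Cayley-Hamilton with reduced trace \<open>2 * qre x\<close> and reduced norm
  \<open>qnorm x\<close>. In norm 1 it gives the inverse \<open>2 * qre x - x\<close>, and at real
  part -1/2 the equation of a primitive cube root of unity.\<close>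

lemma quat_char_poly: "x * x = (2 * qre x) *\<^sub>R x - of_real (qnorm x)"
  by (simp add: quat_eq_iff quat_mult_sel qnorm_def power2_eq_square algebra_simps)

lemma qre_square: "qre (x * x) = 2 * (qre x)\<^sup>2 - qnorm x"
  by (simp add: quat_mult_sel qnorm_def power2_eq_square)

lemma square_pure: "qre x = 0 \<Longrightarrow> x * x = - of_real (qnorm x)"
  by (subst quat_char_poly) simp

lemma square_eq_neg_one_iff: "x * x = - 1 \<longleftrightarrow> qre x = 0 \<and> qnorm x = 1"
proof
  assume sq: "x * x = - 1"
  then have "qnorm x * qnorm x = 1"
    by (metis qnorm_mult qnorm_minus qnorm_1)
  then have n: "qnorm x = 1"
    using qnorm_nonneg[of x] by (metis abs_of_nonneg abs_mult_self_eq abs_one real_sqrt_abs2 real_sqrt_one)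
  from sq n qre_square[of x] show "qre x = 0 \<and> qnorm x = 1" by simp
next
  assume "qre x = 0 \<and> qnorm x = 1"
  then show "x * x = - 1" using square_pure[of x] by simp
qed

text \<open>For pure x and y the sum x y + y x is a scalar, minus twice their inner product. A
  single vanishing trace thus yields anticommutation.\<close>

lemma pure_anticommute:
  assumes "qre x = 0" "qre y = 0" "qre (x * y) = 0"
  shows "x * y = - (y * x)"
  using assms by (simp add: quat_eq_iff quat_mult_sel mult.commute)

lemma anticommute_orthogonal:
  assumes "x * y = - (y * x)"
  shows "qre (x * y) = 0"
  using assms qre_mult_commute[of x y] by simp

text \<open>The centralizer of i is a copy of the complex numbers, where c = qre c - qre (c i) i, so
  its norm is a sum of two squares. In a rational algebra both squares are rational, which is how
  arithmetic enters.\<close>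

lemma qnorm_commuting:
  assumes i: "i * i = - 1" and c: "c * i = i * c"
  shows "qnorm c = (qre c)\<^sup>2 + (qre (c * i))\<^sup>2"
proof -
  from i have 0: "qre i = 0" and 1: "(qi i)\<^sup>2 + (qj i)\<^sup>2 + (qk i)\<^sup>2 = 1"
    by (auto simp: square_eq_neg_one_iff qnorm_def)
  from c 0 have "qj c * qk i - qk c * qj i = 0" "qk c * qi i - qi c * qk i = 0"
      "qi c * qj i - qj c * qi i = 0"
    by (simp_all add: quat_eq_iff quat_mult_sel mult.commute)
  \<comment> \<open>Lagrange's identity for the vector parts; the commutation equations say that
    their cross product vanishes.\<close>
  moreover have "((qi c)\<^sup>2 + (qj c)\<^sup>2 + (qk c)\<^sup>2) * ((qi i)\<^sup>2 + (qj i)\<^sup>2 + (qk i)\<^sup>2)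
      = (qi c * qi i + qj c * qj i + qk c * qk i)\<^sup>2 + (qj c * qk i - qk c * qj i)\<^sup>2
        + (qk c * qi i - qi c * qk i)\<^sup>2 + (qi c * qj i - qj c * qi i)\<^sup>2"
    by (simp add: power2_eq_square algebra_simps)
  ultimately have "(qi c)\<^sup>2 + (qj c)\<^sup>2 + (qk c)\<^sup>2 = (qi c * qi i + qj c * qj i + qk c * qk i)\<^sup>2"
    using 1 by simp
  with 0 show ?thesis
    by (simp add: qnorm_def quat_mult_sel power2_eq_square algebra_simps)
qed

section \<open>Finite subgroups of rational quaternion algebras\<close>

definition qconj :: "quat \<Rightarrow> quat \<Rightarrow> quat"
  where "qconj u x = u * x * inverse u"

lemma inverse_mult_cancel_left: "u \<noteq> 0 \<Longrightarrow> inverse u * (u * x) = x" for u x :: quat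
  by (simp flip: mult.assoc)

lemma qconj_mult: "u \<noteq> 0 \<Longrightarrow> qconj u (x * y) = qconj u x * qconj u y"
  by (simp add: qconj_def mult.assoc inverse_mult_cancel_left)

lemma qconj_1 [simp]: "u \<noteq> 0 \<Longrightarrow> qconj u 1 = 1"
  by (simp add: qconj_def)

lemma qconj_qconj: "u \<noteq> 0 \<Longrightarrow> v \<noteq> 0 \<Longrightarrow> qconj u (qconj v x) = qconj (u * v) x"
  by (simp add: qconj_def nonzero_inverse_mult_distrib mult.assoc)

lemma qconj_inverse [simp]:
  "u \<noteq> 0 \<Longrightarrow> qconj (inverse u) (qconj u x) = x"
  "u \<noteq> 0 \<Longrightarrow> qconj u (qconj (inverse u) x) = x"
  by (simp_all add: qconj_qconj) (simp_all add: qconj_def)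

lemma qconj_eqI: "u \<noteq> 0 \<Longrightarrow> u * x = y * u \<Longrightarrow> qconj u x = y"
  by (simp add: qconj_def mult.assoc)

lemma eq_1_if_qre: "qnorm x = 1 \<Longrightarrow> qre x = 1 \<Longrightarrow> x = 1"
  using qnorm_eq_0_iff[of "x - 1"]
  by (simp add: qnorm_def power2_eq_square algebra_simps)

lemma eq_minus_1_if_qre: "qnorm x = 1 \<Longrightarrow> qre x = - 1 \<Longrightarrow> x = - 1"
  using eq_1_if_qre[of "- x"] by (metis minus_minus qnorm_minus quat_sel(17))

text \<open>Captures what is used of a definite rational quaternion algebra inside the real
  quaternions. Rationality is asked of real parts, since the other standard coordinates carry square
  roots; applied to products such as \<open>x * i\<close> it still controls the coordinates relative
  to elements of S.\<close>

locale rat_quat_algebra =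
  fixes S :: "quat set"
  assumes one_mem [intro, simp]: "1 \<in> S"
    and diff_mem [intro, simp]: "x \<in> S \<Longrightarrow> y \<in> S \<Longrightarrow> x - y \<in> S"
    and mult_mem [intro, simp]: "x \<in> S \<Longrightarrow> y \<in> S \<Longrightarrow> x * y \<in> S"
    and inverse_mem [intro, simp]: "x \<in> S \<Longrightarrow> inverse x \<in> S"
    and qre_rat [intro]: "x \<in> S \<Longrightarrow> qre x \<in> \<rat>"
begin

lemma zero_mem [intro, simp]: "0 \<in> S"
  using diff_mem[OF one_mem one_mem] by simp

lemma minus_mem [intro, simp]: "x \<in> S \<Longrightarrow> - x \<in> S"
  using diff_mem[of 0 x] by simp

lemma add_mem [intro, simp]: "x \<in> S \<Longrightarrow> y \<in> S \<Longrightarrow> x + y \<in> S"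
  using diff_mem[of x "- y"] by simp

lemma of_nat_mem: "of_nat n \<in> S"
  by (induction n) simp_all

lemma of_int_mem: "of_int n \<in> S"
  by (cases n) (auto intro: of_nat_mem simp del: of_nat_Suc)

lemma of_real_mem:
  assumes "r \<in> \<rat>" shows "of_real r \<in> S"
proof -
  obtain m n :: int where n: "n > 0" and r: "r = of_int m / of_int n"
    using assms by (metis Rats_cases')
  have "(of_real r :: quat) = of_real (of_int m) * inverse (of_real (of_int n))"
    unfolding r divide_inverse of_real_mult of_real_inverse ..
  then have "(of_real r :: quat) = of_int m * inverse (of_int n)"
    by (simp only: of_real_of_int_eq)
  then show ?thesis by (simp add: of_int_mem)
qed

text \<open>Closure under inverses is a consequence: in a finite multiplicative set without 0 every
  element has finite order, see \<open>fin_grp_inverse\<close>.\<close>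

definition fin_grp :: "quat set \<Rightarrow> bool"
  where "fin_grp G \<longleftrightarrow> finite G \<and> G \<subseteq> S - {0} \<and> 1 \<in> G \<and> (\<forall>x\<in>G. \<forall>y\<in>G. x * y \<in> G)"

definition max_grp :: "quat set \<Rightarrow> bool"
  where "max_grp G \<longleftrightarrow> fin_grp G \<and> (\<forall>H. fin_grp H \<and> G \<subseteq> H \<longrightarrow> H = G)"

definition conj_grp :: "quat set \<Rightarrow> quat set \<Rightarrow> bool"
  where "conj_grp G H \<longleftrightarrow> (\<exists>u\<in>S - {0}. H = qconj u ` G)"

lemma conj_grp_refl: "conj_grp G G"
  unfolding conj_grp_def by (rule bexI[of _ 1]) (auto simp: qconj_def)

lemma conj_grp_trans:
  assumes "conj_grp G H" "conj_grp H K" shows "conj_grp G K"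
proof -
  obtain u v where "u \<in> S - {0}" "H = qconj u ` G" "v \<in> S - {0}" "K = qconj v ` H"
    using assms unfolding conj_grp_def by blast
  then have "v * u \<in> S - {0}" "K = qconj (v * u) ` G"
    by (auto simp: image_image qconj_qconj)
  then show ?thesis unfolding conj_grp_def by blast
qed

lemma fin_grp_qconj:
  assumes "fin_grp G" "u \<in> S - {0}" shows "fin_grp (qconj u ` G)"
proof -
  have "qconj u ` G \<subseteq> S - {0}"
    using assms unfolding fin_grp_def by (auto simp: qconj_def)
  with assms show ?thesis
    unfolding fin_grp_def by (auto simp: image_iff simp flip: qconj_mult)
      (metis qconj_1)+
qed

lemma max_grp_qconj:
  assumes "max_grp G" "u \<in> S - {0}" shows "max_grp (qconj u ` G)"
proof -
  have "H = qconj u ` G" if H: "fin_grp H" "qconj u ` G \<subseteq> H" for H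
  proof -
    have "G \<subseteq> qconj (inverse u) ` H"
      using H(2) assms(2) by (force simp: image_iff)
    moreover have "fin_grp (qconj (inverse u) ` H)"
      using assms(2) H(1) by (intro fin_grp_qconj) auto
    ultimately have "qconj (inverse u) ` H = G"
      using assms(1) unfolding max_grp_def by blast
    then show ?thesis using assms(2) by (auto simp: image_image)
  qed
  with assms show ?thesis
    unfolding max_grp_def by (auto intro: fin_grp_qconj)
qed

lemma fin_grpD:
  assumes "fin_grp G"
  shows "finite G" "1 \<in> G" "\<And>x. x \<in> G \<Longrightarrow> x \<in> S" "0 \<notin> G"
    "\<And>x y. x \<in> G \<Longrightarrow> y \<in> G \<Longrightarrow> x * y \<in> G"
  using assms unfolding fin_grp_def by auto

lemma fin_grp_power: "fin_grp G \<Longrightarrow> x \<in> G \<Longrightarrow> x ^ n \<in> G"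
  by (induction n) (auto dest: fin_grpD)

lemma fin_grp_order:
  assumes "fin_grp G" "x \<in> G"
  obtains n where "n > 0" "x ^ n = 1"
proof -
  have "range (\<lambda>n. x ^ n) \<subseteq> G"
    using assms fin_grp_power by auto
  then have "\<not> inj (\<lambda>n::nat. x ^ n)"
    using fin_grpD(1)[OF assms(1)] finite_subset range_inj_infinite by blast
  then obtain m n where mn: "m < n" "x ^ m = x ^ n"
    unfolding inj_def by (metis nat_neq_iff)
  have "x \<noteq> 0" using assms fin_grpD(4) by blast
  have "x ^ m * x ^ (n - m) = x ^ n"
    using mn by (metis le_add_diff_inverse less_imp_le power_add)
  then have "x ^ m * x ^ (n - m) = x ^ m * 1"
    using mn by simp
  then have "x ^ (n - m) = 1"
    using \<open>x \<noteq> 0\<close> by (simp only: mult_cancel_left) simp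
  with mn show ?thesis using that[of "n - m"] by simp
qed

lemma fin_grp_inverse:
  assumes "fin_grp G" "x \<in> G" shows "inverse x \<in> G"
proof -
  obtain n where n: "n > 0" "x ^ n = 1" using fin_grp_order[OF assms] .
  then have "x * x ^ (n - 1) = 1" by (cases n) auto
  then have "inverse x = x ^ (n - 1)" using inverse_unique by blast
  then show ?thesis using fin_grp_power[OF assms] by simp
qed

lemma fin_grp_qnorm:
  assumes "fin_grp G" "x \<in> G" shows "qnorm x = 1"
proof -
  obtain n where n: "n > 0" "x ^ n = 1" using fin_grp_order[OF assms] .
  then have "qnorm x ^ n = 1" by (metis qnorm_power qnorm_1)
  with n show ?thesis using power_eq_imp_eq_base[of "qnorm x" n 1] by simp
qed

text \<open>
  The traces of a finite group form a finite set of rationals closed under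
  \<open>t \<mapsto> t\<^sup>2 - 2\<close>; their least common denominator therefore has no prime factor.
\<close>

lemma fin_grp_trace_int:
  assumes G: "fin_grp G" and x: "x \<in> G" shows "2 * qre x \<in> \<int>"
proof -
  define T where "T = (\<lambda>x. 2 * qre x) ` G"
  define den where "den d \<longleftrightarrow> d > 0 \<and> (\<forall>t\<in>T. of_nat d * t \<in> \<int>)" for d :: nat
  have "finite T" using G by (auto simp: T_def dest: fin_grpD)
  have rat: "t \<in> \<rat>" if "t \<in> T" for t
    using that G by (auto simp: T_def dest!: fin_grpD(3) intro!: Rats_mult)
  have sq: "t\<^sup>2 - 2 \<in> T" if t: "t \<in> T" for t
  proof -
    obtain y where y: "y \<in> G" "t = 2 * qre y" using t by (auto simp: T_def)
    then have "t\<^sup>2 - 2 = 2 * qre (y * y)"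
      using fin_grp_qnorm[OF G] by (simp add: qre_square power2_eq_square)
    then show ?thesis using y fin_grpD(5)[OF G] by (auto simp: T_def)
  qed
  have "\<exists>d. den d"
    unfolding den_def using \<open>finite T\<close> rat
  proof (induction T)
    case empty
    show ?case by (rule exI[of _ 1]) simp
  next
    case (insert t T)
    then obtain d where d: "d > 0" "\<And>t. t \<in> T \<Longrightarrow> of_nat d * t \<in> \<int>" by auto
    obtain m n :: int where "n > 0" and t: "t = of_int m / of_int n"
      using insert.prems[of t] by (metis Rats_cases' insertI1)
    define e where "e = nat n"
    have e: "e > 0" "of_nat e * t = of_int m"
      using \<open>n > 0\<close> t by (simp_all add: e_def)
    have "of_nat (d * e) * s \<in> \<int>" if "s \<in> insert t T" for s
    proof (cases "s = t")
      case True
      have "of_nat (d * e) * s = of_nat d * (of_nat e * t)" by (simp add: True)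
      also have "\<dots> = of_int (int d * m)" by (simp only: e of_int_mult of_int_of_nat_eq)
      finally show ?thesis by (metis Ints_of_int)
    next
      case False
      have "of_nat (d * e) * s = of_nat e * (of_nat d * s)" by simp
      then show ?thesis using False that d(2)[of s] by (metis Ints_mult Ints_of_nat insertE)
    qed
    then show ?case using d(1) e(1) by (intro exI[of _ "d * e"]) auto
  qed
  then have "den (LEAST d. den d)" by (rule LeastI_ex)
  define d where "d = (LEAST d. den d)"
  have d: "den d" by (simp add: d_def \<open>den (LEAST d. den d)\<close>)
  have "d = 1"
  proof (rule ccontr)
    assume "d \<noteq> 1"
    then obtain q where q: "Factorial_Ring.prime q" "q dvd d" using prime_factor_nat by blast
    then obtain d' where d': "d = q * d'" by blast
    have "of_nat d' * t \<in> \<int>" if t: "t \<in> T" for t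
    proof -
      obtain m where m: "of_nat d * t = of_int m"
        using d t by (auto simp: den_def elim: Ints_cases)
      obtain l where l: "of_nat d * (t\<^sup>2 - 2) = of_int l"
        using d sq[OF t] by (auto simp: den_def elim: Ints_cases)
      \<comment> \<open>With m = d t, the integer m m equals d (d t t), and d t t = l + 2 d is an
        integer. So q divides m m, hence m, and d / q already clears the denominator of t.\<close>
      have "(of_int (m * m) :: real) = of_nat d * (of_nat d * (t\<^sup>2 - 2) + 2 * of_nat d)"
        by (simp add: m[symmetric] power2_eq_square algebra_simps)
      also have "\<dots> = of_int (int d * (l + 2 * int d))"
        by (simp add: l)
      finally have "m * m = int d * (l + 2 * int d)"
        using of_int_eq_iff by blast
      then have "int q dvd m * m" by (simp add: d')
      then have "int q dvd m"
        using q(1) by (metis prime_dvd_mult_iff prime_nat_int_transfer)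
      then obtain k where "m = int q * k" by blast
      with m have "of_nat q * (of_nat d' * t) = of_nat q * of_int k"
        by (simp add: d')
      then have "of_nat d' * t = of_int k"
        using prime_gt_0_nat[OF q(1)] by simp
      then show ?thesis by simp
    qed
    moreover have "d' > 0" "d' < d" using d d' prime_gt_1_nat[OF q(1)] by (auto simp: den_def)
    ultimately have "den d'" by (simp add: den_def)
    with \<open>d' < d\<close> show False using not_less_Least[of d' den] unfolding d_def by blast
  qed
  with d x show ?thesis by (auto simp: den_def T_def)
qed

text \<open>Norm 1 bounds the trace by 2 in absolute value. The values 2, -2, 0, -1, 1 belong to
  elements of order 1, 2, 4, 3, 6.\<close>

lemma fin_grp_trace:
  assumes "fin_grp G" "x \<in> G"
  obtains t :: int where "2 * qre x = of_int t" "t \<in> {-2, -1, 0, 1, 2}"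
    "t = 2 \<longleftrightarrow> x = 1" "t = -2 \<longleftrightarrow> x = -1"
proof -
  obtain t where t: "2 * qre x = of_int t"
    using fin_grp_trace_int[OF assms] by (auto elim: Ints_cases)
  have n: "qnorm x = 1" using assms by (rule fin_grp_qnorm)
  then have "(qre x)\<^sup>2 \<le> 1"
    unfolding qnorm_def using zero_le_power2[of "qi x"] zero_le_power2[of "qj x"] zero_le_power2[of "qk x"]
    by linarith
  then have "\<bar>qre x\<bar> \<le> 1" by (simp add: abs_square_le_1)
  then have "t \<le> 2" "-2 \<le> t" using t by linarith+
  then have "t \<in> {-2, -1, 0, 1, 2}" by auto
  moreover have "t = 2 \<longleftrightarrow> x = 1" "t = -2 \<longleftrightarrow> x = -1"
    using t eq_1_if_qre[OF n] eq_minus_1_if_qre[OF n] by auto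
  ultimately show ?thesis using that t by blast
qed

text \<open>Since -1 is central, adjoining all negatives gives a finite group again.\<close>

lemma max_grp_uminus:
  assumes G: "max_grp G" and x: "x \<in> G" shows "- x \<in> G"
proof -
  have g: "fin_grp G" using G by (simp add: max_grp_def)
  have "fin_grp (G \<union> uminus ` G)"
    using g unfolding fin_grp_def by auto
  then have "G \<union> uminus ` G = G"
    using G unfolding max_grp_def by blast
  then show ?thesis using x by blast
qed

end

section \<open>Sums of two squares and the prime 3\<close>

lemma three_dvd_sum_squares:
  fixes a b :: int
  assumes "3 dvd a\<^sup>2 + b\<^sup>2" shows "3 dvd a" "3 dvd b"
proof -
  have sq: "x\<^sup>2 mod 3 = (if 3 dvd x then 0 else 1)" for x :: int
  proof -
    have *: "x\<^sup>2 mod 3 = (x mod 3)\<^sup>2 mod 3" by (simp add: power_mod)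
    have "x mod 3 = 0 \<or> x mod 3 = 1 \<or> x mod 3 = 2" by presburger
    then show ?thesis unfolding * dvd_eq_mod_eq_0 by (elim disjE) simp_all
  qed
  have "(a\<^sup>2 mod 3 + b\<^sup>2 mod 3) mod 3 = 0"
    using assms by (simp add: mod_add_eq)
  then show "3 dvd a" "3 dvd b"
    by (simp_all add: sq split: if_splits)
qed

text \<open>Infinite descent: 3 divides a and b, hence c, and dividing all three by 3 gives a
  solution with smaller \<open>\<bar>c\<bar>\<close>.\<close>

lemma sum_squares_eq_three_squares:
  fixes a b c :: int
  assumes "a\<^sup>2 + b\<^sup>2 = 3 * c\<^sup>2" shows "c = 0"
  using assms
proof (induction "nat \<bar>c\<bar>" arbitrary: a b c rule: less_induct)
  case less
  have "3 dvd a" "3 dvd b"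
    using three_dvd_sum_squares[of a b] less.prems by auto
  then obtain a' b' where ab: "a = 3 * a'" "b = 3 * b'" by (elim dvdE)
  then have c: "c\<^sup>2 = 3 * (a'\<^sup>2 + b'\<^sup>2)"
    using less.prems by (simp add: power_mult_distrib)
  then have "3 dvd c"
    using three_dvd_sum_squares[of c 0] by simp
  then obtain c' where c': "c = 3 * c'" by (elim dvdE)
  then have "a'\<^sup>2 + b'\<^sup>2 = 3 * c'\<^sup>2"
    using c by (simp add: power_mult_distrib)
  then show ?case
    using less.hyps[of c' a' b'] c' by (cases "c' = 0") (auto simp: abs_mult)
qed

text \<open>The constant 3/4 is the norm of the pure part of an element of order 3.\<close>

lemma rat_sum_squares_neq_three_fourths:
  fixes r s :: real
  assumes "r \<in> \<rat>" "s \<in> \<rat>" shows "r\<^sup>2 + s\<^sup>2 \<noteq> 3 / 4"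
proof
  assume eq: "r\<^sup>2 + s\<^sup>2 = 3 / 4"
  obtain a b c d :: int where r: "b > 0" "r = of_int a / of_int b"
    and s: "d > 0" "s = of_int c / of_int d"
    using assms by (metis Rats_cases')
  have "of_int (2 * a * d) = 2 * r * of_int (b * d)" "of_int (2 * c * b) = 2 * s * of_int (b * d)"
    using r s by simp_all
  then have "(of_int (2 * a * d))\<^sup>2 + (of_int (2 * c * b))\<^sup>2 = 4 * (r\<^sup>2 + s\<^sup>2) * (of_int (b * d))\<^sup>2"
    by (simp only: power_mult_distrib) (simp add: algebra_simps)
  also have "\<dots> = 3 * (of_int (b * d))\<^sup>2"
    unfolding eq by simp
  finally have "real_of_int ((2 * a * d)\<^sup>2 + (2 * c * b)\<^sup>2) = real_of_int (3 * (b * d)\<^sup>2)"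
    by simp
  then have "(2 * a * d)\<^sup>2 + (2 * c * b)\<^sup>2 = 3 * (b * d)\<^sup>2"
    by (rule of_int_eq_iff[THEN iffD1])
  then have "b * d = 0" by (rule sum_squares_eq_three_squares)
  then show False using r(1) s(1) by simp
qed

lemma qconj_minus: "qconj u (- x) = - qconj u x"
  by (simp add: qconj_def)

lemma qconj_add: "qconj u (x + y) = qconj u x + qconj u y"
  by (simp add: qconj_def algebra_simps)

lemma qconj_scaleR: "qconj u (r *\<^sub>R x) = r *\<^sub>R qconj u x"
  by (simp add: qconj_def)

lemma anticommute_of_qre_0:
  assumes "i * i = - 1" "qre x = 0" "qre (x * i) = 0"
  shows "x * i = - (i * x)"
  using assms by (intro pure_anticommute) (auto simp: square_eq_neg_one_iff)

lemma commute_mult_of_anticommute: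
  fixes x y i :: quat
  assumes "x * i = - (i * x)" "y * i = - (i * y)"
  shows "x * y * i = i * (x * y)"
proof -
  have "x * y * i = - (x * i * y)"
    by (simp add: mult.assoc assms(2))
  also have "\<dots> = i * (x * y)"
    by (simp add: assms(1) mult.assoc)
  finally show ?thesis .
qed

lemma anticommute_inverse:
  fixes x i :: quat
  assumes "x * i = - (i * x)" "x \<noteq> 0"
  shows "inverse x * i = - (i * inverse x)"
proof -
  have "inverse x * (x * i) * inverse x = - (inverse x * (i * x) * inverse x)"
    by (simp add: assms(1))
  then show ?thesis
    using assms(2) by (simp add: mult.assoc inverse_mult_cancel_left)
qed

section \<open>Explicit conjugations, and finite groups relative to a square root of -1\<close>

context rat_quat_algebra
begin

text \<open>Skolem-Noether made explicit: (a + b) a = b b + b a = b (a + b), so a + b conjugates a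
  to b and lies in S.\<close>

lemma conj_pure:
  assumes "a \<in> S" "b \<in> S" "a * a = b * b" "b \<noteq> - a"
  obtains u where "u \<in> S - {0}" "qconj u a = b"
proof
  show u: "a + b \<in> S - {0}"
    using assms add_eq_0_iff[of a b] by auto
  then show "qconj (a + b) a = b"
    by (intro qconj_eqI) (auto simp: distrib_left distrib_right assms(3))
qed

text \<open>Both a + b and a anticommute with i, so u = (a + b) / a commutes with i, and it still
  carries a to b. If b = -a this u vanishes, but then i itself negates a.\<close>

lemma conj_pure_fixing:
  assumes i: "i \<in> S" "i * i = - 1"
    and a: "a \<in> S" "a * i = - (i * a)" and b: "b \<in> S" "b * i = - (i * b)"
    and ab: "a * a = b * b" "a \<noteq> 0"
  obtains u where "u \<in> S - {0}" "qconj u i = i" "qconj u a = b"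
proof (cases "b = - a")
  case True
  have "i \<noteq> 0" using i(2) by auto
  then have "qconj i a = b" "qconj i i = i"
    by (auto intro!: qconj_eqI simp: True a(2))
  then show ?thesis using that \<open>i \<noteq> 0\<close> i(1) by blast
next
  case False
  define u where "u = 1 + b * inverse a"
  have ua: "u * a = a + b"
    using ab(2) by (simp add: u_def distrib_right mult.assoc)
  have "b * u = b + b * b * inverse a"
    by (simp add: u_def distrib_left mult.assoc)
  then have bu: "b * u = a + b"
    using ab(2) by (simp add: ab(1)[symmetric] mult.assoc add.commute)
  have "u \<noteq> 0" using ua False add_eq_0_iff[of a b] by auto
  moreover have "u \<in> S" using a b by (auto simp: u_def)
  moreover have "u * i = i * u"
    using commute_mult_of_anticommute[OF b(2) anticommute_inverse[OF a(2) ab(2)]]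
    by (simp add: u_def distrib_left distrib_right)
  ultimately show ?thesis
    using that[of u] ua bu by (simp add: qconj_eqI)
qed

text \<open>The traces t of g and s of g i describe the component of g in the field generated by i.
  A value of size 2 puts g among the powers of i. Two zeros make g an anticommuting root of -1. If
  just one value is nonzero, of size 1, a power of i moves it to the real part and makes it -1/2.
  Two values of size 1 make the conjugate of i by g anticommute with i.\<close>

lemma fin_grp_order4_cases:
  assumes G: "fin_grp G" and i: "i \<in> G" "i * i = - 1" and g: "g \<in> G"
  shows "g \<in> {1, - 1, i, - i} \<or> (\<exists>j\<in>G. j * j = - 1 \<and> j * i = - (i * j)) \<or>
    (\<exists>h\<in>{1, - 1, i, - i}. qre (g * h) = - 1 / 2 \<and> qre (g * h * i) = 0)"
proof -
  note mult = fin_grpD(5)[OF G]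
  have n: "qnorm g = 1" using G g by (rule fin_grp_qnorm)
  obtain t where t: "2 * qre g = of_int t" "t \<in> {-2, -1, 0, 1, 2}"
    "t = 2 \<longleftrightarrow> g = 1" "t = -2 \<longleftrightarrow> g = - 1"
    using fin_grp_trace[OF G g] .
  obtain s where s: "2 * qre (g * i) = of_int s" "s \<in> {-2, -1, 0, 1, 2}"
    "s = 2 \<longleftrightarrow> g * i = 1" "s = -2 \<longleftrightarrow> g * i = - 1"
    using fin_grp_trace[OF G mult[OF g i(1)]] .
  have gii: "g * i * i = - g" by (simp add: mult.assoc i(2))
  have gen: "g = - i" if "g * i = 1" using gii that by auto
  have gen': "g = i" if "g * i = - 1" using gii that by auto
  consider "\<bar>t\<bar> = 2 \<or> \<bar>s\<bar> = 2" | "t = 0" "s = 0" | "\<bar>t\<bar> = 1" "s = 0" | "t = 0" "\<bar>s\<bar> = 1"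
    | "\<bar>t\<bar> = 1" "\<bar>s\<bar> = 1"
    using t(2) s(2) by auto
  then show ?thesis
  proof cases
    case 1
    then have "g \<in> {1, - 1, i, - i}" using t s gen gen' by auto
    then show ?thesis by blast
  next
    case 2
    then have "qre g = 0" "qre (g * i) = 0" using t s by auto
    then have "g * g = - 1" "g * i = - (i * g)"
      using n i(2) by (auto simp: square_eq_neg_one_iff intro: anticommute_of_qre_0)
    then show ?thesis using g by blast
  next
    case 3
    define h :: quat where "h = (if t = - 1 then 1 else - 1)"
    have "qre (g * h) = - 1 / 2" "qre (g * h * i) = 0" "h \<in> {1, - 1, i, - i}"
      using 3 t(1) s(1) by (auto simp: h_def)
    then show ?thesis by blast
  next
    case 4
    define h :: quat where "h = (if s = - 1 then i else - i)"
    have "qre (g * h) = - 1 / 2" "qre (g * h * i) = 0" "h \<in> {1, - 1, i, - i}"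
      using 4 t(1) s(1) by (auto simp: h_def gii)
    then show ?thesis by blast
  next
    case 5
    define j where "j = qconj g i"
    have "g \<noteq> 0" using G g fin_grpD(4) by blast
    have inv: "inverse g = (2 * qre g) *\<^sub>R 1 - g"
      by (rule inverse_unique) (simp add: right_diff_distrib quat_char_poly[of g] n)
    have "j \<in> G" using G g i(1) by (auto simp: j_def qconj_def intro: mult fin_grp_inverse)
    moreover have jj: "j * j = - 1"
      using \<open>g \<noteq> 0\<close> i(2) by (simp add: j_def qconj_minus flip: qconj_mult)
    moreover have "j * i = - (i * j)"
    proof (rule anticommute_of_qre_0[OF i(2)])
      show "qre j = 0" using jj by (simp add: square_eq_neg_one_iff)
      \<comment> \<open>In norm 1 the inverse of g is \<open>2 * qre g - g\<close>. Expanding gives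
        real part 1 - (t t + s s) / 2 for j i, which is 0 when both traces have size 1.\<close>
      have "j * i = (2 * qre g) *\<^sub>R (g * i * i) - (g * i) * (g * i)"
        by (simp add: j_def qconj_def inv algebra_simps)
      then have "qre (j * i) = - (2 * (qre g)\<^sup>2) - (2 * (qre (g * i))\<^sup>2 - qnorm (g * i))"
        unfolding gii by (simp add: qre_square power2_eq_square)
      moreover have "qnorm (g * i) = 1" using fin_grp_qnorm[OF G mult[OF g i(1)]] .
      moreover have "qre (g * i) = of_int s / 2" "qre g = of_int t / 2" using t(1) s(1) by simp_all
      ultimately have "qre (j * i) = 1 - of_int (t\<^sup>2) / 2 - of_int (s\<^sup>2) / 2"
        by (simp add: power2_eq_square)
      moreover have "t\<^sup>2 = 1" "s\<^sup>2 = 1"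
        using 5 by (metis power2_abs power_one)+
      ultimately show "qre (j * i) = 0" by simp
    qed
    ultimately show ?thesis by blast
  qed
qed

text \<open>Here x = -1/2 + w with w pure, so the norm of w is 1 - 1/4. Passing to w replaces an
  element of order 3 by one to which the anticommutation lemmas apply.\<close>

lemma pure_part:
  assumes "i * i = - 1" "qre x = - 1 / 2" "qre (x * i) = 0" "qnorm x = 1"
  defines "w \<equiv> x + (1 / 2) *\<^sub>R 1"
  shows "qre w = 0" "w * i = - (i * w)" "w * w = (- 3 / 4) *\<^sub>R 1" "qnorm w = 3 / 4" "w \<noteq> 0"
proof -
  have i: "qre i = 0" using assms(1) by (simp add: square_eq_neg_one_iff)
  show re: "qre w = 0" using assms(2) by (simp add: w_def)
  have "qre (w * i) = 0"
    using assms(3) i by (simp add: w_def quat_mult_sel)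
  with re show "w * i = - (i * w)" using assms(1) by (intro anticommute_of_qre_0)
  show n: "qnorm w = 3 / 4"
    using assms(2,4) by (simp add: w_def qnorm_def power2_eq_square)
  then show "w \<noteq> 0" by (auto simp: qnorm_def)
  show "w * w = (- 3 / 4) *\<^sub>R 1"
    unfolding square_pure[OF re] n of_real_def by simp
qed

text \<open>
  This is where \<open>(-1, -1)\<close> and \<open>(-1, -3)\<close> are seen not to be isomorphic over the rationals.
\<close>

lemma no_order4_order3_mix:
  assumes i: "i \<in> S" "i * i = - 1"
    and j: "j \<in> S" "j * j = - 1" "j * i = - (i * j)"
    and x: "x \<in> S" "qnorm x = 1" "qre x = - 1 / 2" "qre (x * i) = 0"
  shows False
proof -
  define w where "w = x + (1 / 2) *\<^sub>R 1"
  note w = pure_part[OF i(2) x(3,4,2), folded w_def]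
  have "w \<in> S"
    using of_real_mem[of "1 / 2"] x(1) unfolding w_def of_real_def by (intro add_mem) auto
  \<comment> \<open>Both w and j anticommute with i, so w j commutes with it, and its norm 3/4
    becomes a sum of two rational squares.\<close>
  have "qnorm (w * j) = (qre (w * j))\<^sup>2 + (qre (w * j * i))\<^sup>2"
    using i(2) commute_mult_of_anticommute[OF w(2) j(3)] by (rule qnorm_commuting)
  moreover have "qnorm (w * j) = 3 / 4"
    using w(4) j(2) by (simp add: qnorm_mult square_eq_neg_one_iff)
  moreover have "qre (w * j) \<in> \<rat>" "qre (w * j * i) \<in> \<rat>"
    using \<open>w \<in> S\<close> i(1) j(1) by auto
  ultimately show False using rat_sum_squares_neq_three_fourths by metis
qed

text \<open>The product c of the pure parts w, v of y, x commutes with i and has norm 9/16.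
  Integrality of the traces of y x and y x i makes 4 c a Gaussian integer of norm 9 with odd real
  and even imaginary part, hence 3 or -3. So w is v or -v, and y is x or its conjugate x x.\<close>

lemma order3_unique:
  assumes G: "fin_grp G" and i: "i \<in> G" "i * i = - 1"
    and x: "x \<in> G" "qre x = - 1 / 2" "qre (x * i) = 0"
    and y: "y \<in> G" "qre y = - 1 / 2" "qre (y * i) = 0"
  shows "y = x \<or> y = x * x"
proof -
  define v where "v = x + (1 / 2) *\<^sub>R 1"
  define w where "w = y + (1 / 2) *\<^sub>R 1"
  have nx: "qnorm x = 1" and ny: "qnorm y = 1" using G x(1) y(1) fin_grp_qnorm by auto
  note v = pure_part[OF i(2) x(2,3) nx, folded v_def]
  note w = pure_part[OF i(2) y(2,3) ny, folded w_def]
  define c where "c = w * v"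
  have c: "c * i = i * c"
    unfolding c_def by (rule commute_mult_of_anticommute[OF w(2) v(2)])
  have "qnorm c = 9 / 16" by (simp add: c_def qnorm_mult v w)
  with qnorm_commuting[OF i(2) c] have eq: "(4 * qre c)\<^sup>2 + (4 * qre (c * i))\<^sup>2 = 9"
    by (simp add: power_mult_distrib)
  \<comment> \<open>As v and w are pure and orthogonal to i, only c and 1/4 contribute to the real
    part of y x, and only c to that of y x i.\<close>
  have yx: "y * x = c - (1 / 2) *\<^sub>R w - (1 / 2) *\<^sub>R v + (1 / 4) *\<^sub>R 1"
    by (simp add: c_def v_def w_def algebra_simps of_real_def)
  have "qre (v * i) = 0" "qre (w * i) = 0"
    using anticommute_orthogonal v(2) w(2) by auto
  moreover have "qre i = 0" using i(2) by (simp add: square_eq_neg_one_iff)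
  ultimately have "2 * qre (y * x) = (4 * qre c + 1) / 2" "2 * qre (y * x * i) = 4 * qre (c * i) / 2"
    unfolding yx by (simp_all add: v w algebra_simps of_real_def)
  moreover have "y * x \<in> G" "y * x * i \<in> G" using x y i G fin_grpD(5) by auto
  ultimately have "(4 * qre c + 1) / 2 \<in> \<int>" "4 * qre (c * i) / 2 \<in> \<int>"
    using fin_grp_trace_int[OF G] by metis+
  then obtain m n :: int where "(4 * qre c + 1) / 2 = of_int m" "4 * qre (c * i) / 2 = of_int n"
    by (elim Ints_cases)
  then have mn: "4 * qre c = of_int (2 * m - 1)" "4 * qre (c * i) = of_int (2 * n)"
    by simp_all
  then have "real_of_int ((2 * m - 1)\<^sup>2 + (2 * n)\<^sup>2) = real_of_int 9"
    using eq unfolding mn by simp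
  then have mn9: "(2 * m - 1)\<^sup>2 + (2 * n)\<^sup>2 = 9"
    by (rule of_int_eq_iff[THEN iffD1])
  \<comment> \<open>If \<open>\<bar>n\<bar>\<close> is at least 2, the odd square would be negative.
    If it is 1, the odd square would be 5, so that m (m - 1) = 1, although that product is
    even.\<close>
  have "n = 0"
  proof (rule ccontr)
    assume "n \<noteq> 0"
    have "\<bar>n\<bar> \<le> 1"
    proof (rule ccontr)
      assume "\<not> \<bar>n\<bar> \<le> 1"
      then have "2\<^sup>2 \<le> \<bar>n\<bar>\<^sup>2" by (intro power_mono) auto
      then have "4 \<le> n\<^sup>2" by simp
      moreover have "(2 * m - 1)\<^sup>2 + 4 * n\<^sup>2 = 9" using mn9 by simp
      ultimately show False using zero_le_power2[of "2 * m - 1"] by linarith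
    qed
    with \<open>n \<noteq> 0\<close> have "n = 1 \<or> n = - 1" by auto
    with mn9 have "(2 * m - 1)\<^sup>2 = 5" by auto
    then have "4 * (m * m - m) = 4" by (simp add: power2_eq_square algebra_simps)
    then have "m * (m - 1) = 1" by (simp add: algebra_simps)
    moreover have "even (m * (m - 1))" by simp
    ultimately show False by simp
  qed
  with mn have ci: "qre (c * i) = 0" by simp
  with eq have "(qre c)\<^sup>2 = (3 / 4)\<^sup>2" by (simp add: power_mult_distrib power2_eq_square)
  then have re: "qre c = 3 / 4 \<or> qre c = - 3 / 4" by (auto simp: power2_eq_iff)
  have "qnorm (c - of_real (qre c)) = qnorm c - (qre c)\<^sup>2"
    by (simp add: qnorm_def)
  also have "\<dots> = 0" using qnorm_commuting[OF i(2) c] ci by simp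
  finally have "c = of_real (qre c)" by simp
  then have "w * v * v = of_real (qre c) * v" by (simp add: c_def)
  moreover have "w * v * v = - (3 / 4) *\<^sub>R w"
    by (simp add: mult.assoc v(3) of_real_def)
  ultimately have "w = (- 4 / 3 * qre c) *\<^sub>R v"
    by (simp add: scaleR_conv_of_real[symmetric] quat_eq_iff)
  moreover have "- 4 / 3 * qre c = 1 \<or> - 4 / 3 * qre c = - 1" using re by auto
  ultimately have "w = v \<or> w = - v" by (metis scaleR_one scaleR_minus1_left)
  then show ?thesis
  proof
    assume "w = v"
    then show ?thesis by (simp add: v_def w_def)
  next
    assume "w = - v"
    then have "y = - 1 - x" by (simp add: v_def w_def quat_eq_iff)
    moreover have "x * x = - 1 - x"
      using quat_char_poly[of x] x(2) nx by simp
    ultimately show ?thesis by simp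
  qed
qed

end

section \<open>Hurwitz units\<close>

text \<open>The real-linear map taking the standard basis to 1, i, j, i j. Under the quaternion
  relations it is multiplicative, so calculations with an arbitrary pair i, j reduce to standard
  coordinates.\<close>

definition qframe :: "quat \<Rightarrow> quat \<Rightarrow> quat \<Rightarrow> quat"
  where "qframe i j x = qre x *\<^sub>R 1 + qi x *\<^sub>R i + qj x *\<^sub>R j + qk x *\<^sub>R (i * j)"

lemma qframe_mult:
  assumes i: "i * i = - 1" and j: "j * j = - 1" and ji: "j * i = - (i * j)"
  shows "qframe i j x * qframe i j y = qframe i j (x * y)"
proof -
  have i': "i * (i * z) = - z" for z
    by (simp add: i flip: mult.assoc)
  have j': "j * (j * z) = - z" for z
    by (simp add: j flip: mult.assoc)
  have ji': "j * (i * z) = - (i * (j * z))" for z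
    by (metis ji mult.assoc mult_minus_left)
  show ?thesis
    by (simp add: qframe_def distrib_left distrib_right mult.assoc i j ji i' j' ji' quat_mult_sel
        scaleR_left_distrib scaleR_left_diff_distrib scaleR_right_distrib scaleR_right_diff_distrib)
      (simp add: algebra_simps)
qed

text \<open>The basis 1, i, j, i j is orthonormal, so real parts of products give the coordinates.
  The remainder y is orthogonal to all four: it anticommutes with i, j and i j. Anticommuting with i
  and j it also commutes with i j, which forces y = 0.\<close>

lemma qframe_expand:
  assumes i: "i * i = - 1" and j: "j * j = - 1" and ji: "j * i = - (i * j)"
  shows "x = qframe i j (Quat (qre x) (- qre (x * i)) (- qre (x * j)) (- qre (x * (i * j))))"
proof -
  have ij: "(i * j) * (i * j) = - 1"
    by (metis i j ji mult.assoc mult.right_neutral mult_minus_left mult_minus_right minus_minus)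
  note re = i[unfolded square_eq_neg_one_iff, THEN conjunct1] j[unfolded square_eq_neg_one_iff, THEN conjunct1]
    ij[unfolded square_eq_neg_one_iff, THEN conjunct1]
  have re': "qre (j * i) = 0" using re(3) ji by simp
  have iij: "i * (i * j) = - j" "j * (i * j) = i" "i * j * i = j" "i * j * j = - i"
    by (simp add: i flip: mult.assoc) (metis i j ji mult.assoc mult.right_neutral mult_1_left mult_minus_left mult_minus_right minus_minus)+
  define y where "y = x - qframe i j (Quat (qre x) (- qre (x * i)) (- qre (x * j)) (- qre (x * (i * j))))"
  have "qre y = 0" "qre (y * i) = 0" "qre (y * j) = 0" "qre (y * (i * j)) = 0"
    unfolding y_def qframe_def
    by (simp_all add: left_diff_distrib distrib_right re re' i j ij iij del: minus_mult_left)
  then have "y * i = - (i * y)" "y * j = - (j * y)" "y * (i * j) = - (i * j * y)"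
    using i j ij by (auto intro!: anticommute_of_qre_0)
  then have "y * (i * j) = - (y * (i * j))"
    using commute_mult_of_anticommute[of i y j] by simp
  then have "y * (i * j) = 0" by (simp add: quat_eq_iff)
  then have "y = 0" using i j by auto
  then show ?thesis by (simp add: y_def)
qed

text \<open>Squares are 0 or 1 modulo 4, so four of them add up to a multiple of 4 only if all have
  the same parity.\<close>

lemma four_squares_parity:
  fixes a b c d :: int
  assumes "a\<^sup>2 + b\<^sup>2 + c\<^sup>2 + d\<^sup>2 = 4"
  shows "even a = even b" "even a = even c" "even a = even d"
proof -
  have sq: "x\<^sup>2 mod 4 = (if even x then 0 else 1)" for x :: int
  proof -
    have *: "x\<^sup>2 mod 4 = (x mod 4)\<^sup>2 mod 4" by (simp add: power_mod)
    have "x mod 4 = 0 \<or> x mod 4 = 1 \<or> x mod 4 = 2 \<or> x mod 4 = 3" by presburger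
    moreover have "even x \<longleftrightarrow> even (x mod 4)" by presburger
    ultimately show ?thesis unfolding * by (elim disjE) simp_all
  qed
  have mod4: "(w mod 4 + x mod 4 + y mod 4 + z mod 4) mod 4 = (w + x + y + z) mod 4" for w x y z :: int
    by (intro mod_add_cong) simp_all
  have "(a\<^sup>2 mod 4 + b\<^sup>2 mod 4 + c\<^sup>2 mod 4 + d\<^sup>2 mod 4) mod 4 = 0"
    by (subst mod4) (simp add: assms)
  then show "even a = even b" "even a = even c" "even a = even d"
    by (simp_all add: sq split: if_splits)
qed

context rat_quat_algebra
begin

text \<open>The binary tetrahedral group of Hurwitz units in the frame \<open>i, j\<close>.\<close>

definition hurwitz_units :: "quat \<Rightarrow> quat \<Rightarrow> quat set"
  where "hurwitz_units i j = {qframe i j ((1 / 2) *\<^sub>R Quat (of_int a) (of_int b) (of_int c) (of_int d)) | a b c d.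
    a\<^sup>2 + b\<^sup>2 + c\<^sup>2 + d\<^sup>2 = 4}"

lemma fin_grp_hurwitz_units:
  assumes ij: "i \<in> S" "j \<in> S" and rel: "i * i = - 1" "j * j = - 1" "j * i = - (i * j)"
  shows "fin_grp (hurwitz_units i j)"
proof -
  let ?h = "\<lambda>(a, b, c, d). qframe i j ((1 / 2) *\<^sub>R Quat (of_int a) (of_int b) (of_int c) (of_int d))"
  let ?N = "\<lambda>a b c d :: int. a\<^sup>2 + b\<^sup>2 + c\<^sup>2 + d\<^sup>2"
  have bound: "a \<in> {-2..2}" if "a\<^sup>2 \<le> 4" for a :: int
    using that abs_le_square_iff[of a 2] by auto
  have "hurwitz_units i j \<subseteq> ?h ` ({-2..2} \<times> {-2..2} \<times> {-2..2} \<times> {-2..2})"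
  proof
    fix x assume "x \<in> hurwitz_units i j"
    then obtain a b c d where N: "?N a b c d = 4" and x: "x = ?h (a, b, c, d)"
      unfolding hurwitz_units_def by auto
    have "a\<^sup>2 \<le> 4" "b\<^sup>2 \<le> 4" "c\<^sup>2 \<le> 4" "d\<^sup>2 \<le> 4"
      using N zero_le_power2[of a] zero_le_power2[of b] zero_le_power2[of c] zero_le_power2[of d]
      by linarith+
    then have "a \<in> {-2..2}" "b \<in> {-2..2}" "c \<in> {-2..2}" "d \<in> {-2..2}"
      by (simp_all add: bound del: atLeastAtMost_iff)
    then show "x \<in> ?h ` ({-2..2} \<times> {-2..2} \<times> {-2..2} \<times> {-2..2})"
      using x by blast
  qed
  then have fin: "finite (hurwitz_units i j)"
    by (rule finite_subset) auto
  have mult: "x * y \<in> hurwitz_units i j" if x: "x \<in> hurwitz_units i j" and y: "y \<in> hurwitz_units i j" for x y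
  proof -
    obtain a b c d where N: "?N a b c d = 4" and x: "x = ?h (a, b, c, d)"
      using x unfolding hurwitz_units_def by auto
    obtain a' b' c' d' where N': "?N a' b' c' d' = 4" and y: "y = ?h (a', b', c', d')"
      using y unfolding hurwitz_units_def by auto
    note par = four_squares_parity[OF N] four_squares_parity[OF N']
    \<comment> \<open>Within each quadruple all parities agree, so the four terms of each expression
      have equal parity. Halving these numbers turns the sum of squares 4 * 4 into 4 again.\<close>
    have "even (a * a' - b * b' - c * c' - d * d')" "even (a * b' + b * a' + c * d' - d * c')"
      "even (a * c' + c * a' + d * b' - b * d')" "even (a * d' + d * a' + b * c' - c * b')"
      using par by auto
    then obtain r s t u where r: "a * a' - b * b' - c * c' - d * d' = 2 * r"
        "a * b' + b * a' + c * d' - d * c' = 2 * s" "a * c' + c * a' + d * b' - b * d' = 2 * t"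
        "a * d' + d * a' + b * c' - c * b' = 2 * u"
      by (elim evenE)
    have "?N (2 * r) (2 * s) (2 * t) (2 * u) = ?N a b c d * ?N a' b' c' d'"
      unfolding r[symmetric] by (simp add: power2_eq_square algebra_simps)
    then have "?N r s t u = 4" by (simp add: N N' power_mult_distrib)
    moreover have "x * y = ?h (r, s, t, u)"
    proof -
      have "(1 / 2) *\<^sub>R Quat (of_int a) (of_int b) (of_int c) (of_int d)
          * (1 / 2) *\<^sub>R Quat (of_int a') (of_int b') (of_int c') (of_int d')
        = (1 / 4) *\<^sub>R Quat (of_int (2 * r)) (of_int (2 * s)) (of_int (2 * t)) (of_int (2 * u))"
        unfolding r[symmetric] by (simp add: quat_eq_iff quat_mult_sel)
      also have "\<dots> = (1 / 2) *\<^sub>R Quat (of_int r) (of_int s) (of_int t) (of_int u)"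
        by (simp add: quat_eq_iff)
      finally show ?thesis unfolding x y by (simp add: qframe_mult[OF rel])
    qed
    ultimately show ?thesis unfolding hurwitz_units_def by auto
  qed
  have one: "1 \<in> hurwitz_units i j"
    unfolding hurwitz_units_def mem_Collect_eq
    by (rule exI[of _ 2], (rule exI[of _ 0])+) (simp add: qframe_def)
  have "x \<in> S - {0}" if x: "x \<in> hurwitz_units i j" for x
  proof
    obtain a b c d where N: "?N a b c d = 4" and x: "x = ?h (a, b, c, d)"
      using x unfolding hurwitz_units_def by auto
    have "r *\<^sub>R z \<in> S" if "r \<in> \<rat>" "z \<in> S" for r z
      using that of_real_mem by (simp add: scaleR_conv_of_real)
    then show "x \<in> S"
      using ij by (auto simp: x qframe_def)
    let ?q = "(1 / 2) *\<^sub>R Quat (of_int a) (of_int b) (of_int c) (of_int d)"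
    \<comment> \<open>The conjugate coordinates give an inverse of x, whence x is nonzero.\<close>
    let ?r = "(1 / 2) *\<^sub>R Quat (of_int a) (- of_int b) (- of_int c) (- of_int d)"
    have "?q * ?r = (1 / 4 * of_int (?N a b c d)) *\<^sub>R 1"
      by (simp add: quat_eq_iff quat_mult_sel power2_eq_square)
    then have qr: "?q * ?r = 1" unfolding N by simp
    have "x * qframe i j ?r = 1"
      unfolding x prod.case qframe_mult[OF rel] qr by (simp add: qframe_def)
    then show "x \<notin> {0}" by auto
  qed
  with fin mult one show ?thesis unfolding fin_grp_def by auto
qed

text \<open>The coordinates of g in the frame are, up to sign, half the traces of g, g i, g j and g
  i j, all of them elements of G. They are therefore half-integers, and norm 1 becomes the
  four-square equation.\<close>

lemma fin_grp_subset_hurwitz_units: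
  assumes G: "fin_grp G" and ij: "i \<in> G" "j \<in> G" and rel: "i * i = - 1" "j * j = - 1" "j * i = - (i * j)"
  shows "G \<subseteq> hurwitz_units i j"
proof
  fix g assume g: "g \<in> G"
  note mult = fin_grpD(5)[OF G]
  have tr: "\<exists>t::int. - qre x = of_int t / 2" if x: "x \<in> G" for x
  proof -
    obtain t where "2 * qre x = of_int t"
      using fin_grp_trace_int[OF G x] by (auto elim: Ints_cases)
    then have "- qre x = of_int (- t) / 2" by simp
    then show ?thesis by blast
  qed
  obtain a b c d where t: "- qre g = of_int a / 2" "- qre (g * i) = of_int b / 2"
    "- qre (g * j) = of_int c / 2" "- qre (g * (i * j)) = of_int d / 2"
    using tr[OF g] tr[OF mult[OF g ij(1)]] tr[OF mult[OF g ij(2)]]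
      tr[OF mult[OF g mult[OF ij]]] by metis
  \<comment> \<open>All real parts were obtained negated, as the coordinates along i, j and i j
    require; the scalar coordinate is negated back.\<close>
  let ?q = "(1 / 2) *\<^sub>R Quat (of_int (- a)) (of_int b) (of_int c) (of_int d)"
  let ?r = "(1 / 2) *\<^sub>R Quat (of_int (- a)) (- of_int b) (- of_int c) (- of_int d)"
  have pure: "qre i = 0" "qre j = 0" "qre (i * j) = 0"
    using rel anticommute_orthogonal[OF rel(3)] by (simp_all add: square_eq_neg_one_iff)
  have "qre g = of_int (- a) / 2" using t(1) by simp
  then have gq: "g = qframe i j ?q"
    by (subst qframe_expand[OF rel, of g]) (simp only: t scaleR_quat_def quat.sel, simp)
  have 1: "?q * ?r = (of_int (a\<^sup>2 + b\<^sup>2 + c\<^sup>2 + d\<^sup>2) / 4) *\<^sub>R 1"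
    by (simp add: quat_eq_iff quat_mult_sel power2_eq_square)
  have "g * qframe i j ?r = (of_int (a\<^sup>2 + b\<^sup>2 + c\<^sup>2 + d\<^sup>2) / 4) *\<^sub>R 1"
    unfolding gq qframe_mult[OF rel] 1 by (simp add: qframe_def)
  moreover have "qframe i j ?r = (2 * qre g) *\<^sub>R 1 - g"
    using arg_cong[OF gq, of qre] by (subst (2) gq) (simp add: qframe_def pure quat_eq_iff)
  moreover have "g * ((2 * qre g) *\<^sub>R 1 - g) = 1"
    using fin_grp_qnorm[OF G g] quat_char_poly[of g] by (simp add: right_diff_distrib)
  ultimately have "of_int (a\<^sup>2 + b\<^sup>2 + c\<^sup>2 + d\<^sup>2) / 4 = (1::real)"
    by (metis quat_scaleR_sel(1) quat_sel(5) mult.right_neutral)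
  then have "real_of_int (a\<^sup>2 + b\<^sup>2 + c\<^sup>2 + d\<^sup>2) = of_int 4" by simp
  then have "(- a)\<^sup>2 + b\<^sup>2 + c\<^sup>2 + d\<^sup>2 = 4"
    unfolding of_int_eq_iff by simp
  with gq show "g \<in> hurwitz_units i j"
    unfolding hurwitz_units_def by blast
qed

text \<open>In particular, maximal groups that share the pair i, j coincide.\<close>

lemma max_grp_eq_hurwitz_units:
  assumes G: "max_grp G" and ij: "i \<in> G" "j \<in> G" and rel: "i * i = - 1" "j * j = - 1" "j * i = - (i * j)"
  shows "G = hurwitz_units i j"
proof -
  have g: "fin_grp G" using G by (simp add: max_grp_def)
  then have "fin_grp (hurwitz_units i j)"
    using ij rel by (intro fin_grp_hurwitz_units) (auto dest: fin_grpD)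
  then show ?thesis
    using G fin_grp_subset_hurwitz_units[OF g ij rel] unfolding max_grp_def by blast
qed

end

section \<open>Conjugacy of maximal finite subgroups\<close>

context rat_quat_algebra
begin

lemma max_grp_fin_grp: "max_grp G \<Longrightarrow> fin_grp G"
  by (simp add: max_grp_def)

lemma max_grp_subset_eq: "max_grp G \<Longrightarrow> fin_grp H \<Longrightarrow> G \<subseteq> H \<Longrightarrow> H = G"
  by (simp add: max_grp_def)

lemma conj_grp_if_qconj:
  "u \<in> S - {0} \<Longrightarrow> conj_grp (qconj u ` G) H \<Longrightarrow> conj_grp G H"
  by (rule conj_grp_trans[of _ "qconj u ` G"]) (auto simp: conj_grp_def)

text \<open>A group beyond the powers of i is pinned down by i and one more element: an
  anticommuting root of -1 (\<open>Q\<close>, through \<open>hurwitz_units\<close>) or an element of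
  order 3 orthogonal to i (\<open>W\<close>, through \<open>order3_unique\<close>).
  \<open>conj_pure_fixing\<close> matches the second elements while keeping i.\<close>

lemma conj_grp_of_common_order4:
  assumes G: "max_grp G" and H: "max_grp H" and iG: "i \<in> G" and iH: "i \<in> H" and ii: "i * i = - 1"
  shows "conj_grp G H"
proof -
  define Q where "Q K \<longleftrightarrow> (\<exists>j\<in>K. j * j = - 1 \<and> j * i = - (i * j))" for K
  define W where "W K \<longleftrightarrow> (\<exists>x\<in>K. qre x = - 1 / 2 \<and> qre (x * i) = 0)" for K
  have C: "{1, - 1, i, - i} \<subseteq> K" if "max_grp K" "i \<in> K" for K
    using that fin_grpD(2)[OF max_grp_fin_grp] by (auto intro: max_grp_uminus)
  have cases: "K \<subseteq> {1, - 1, i, - i} \<or> Q K \<or> W K" if K: "max_grp K" "i \<in> K" for K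
  proof (rule ccontr)
    assume neg: "\<not> ?thesis"
    then obtain g where g: "g \<in> K" "g \<notin> {1, - 1, i, - i}" by blast
    then obtain h where h: "h \<in> {1, - 1, i, - i}" "qre (g * h) = - 1 / 2" "qre (g * h * i) = 0"
      using fin_grp_order4_cases[OF max_grp_fin_grp[OF K(1)] K(2) ii g(1)] neg unfolding Q_def by blast
    moreover have "g * h \<in> K"
      using C[OF K] g(1) h(1) fin_grpD(5)[OF max_grp_fin_grp[OF K(1)]] by blast
    ultimately show False using neg unfolding W_def by blast
  qed
  \<comment> \<open>K and L may differ: the exclusion concerns elements of S, so G and H cannot be
    of opposite types.\<close>
  have mix: False if "Q K" "fin_grp K" "W L" "fin_grp L" "i \<in> K" for K L
    using that ii unfolding Q_def W_def
    by (metis no_order4_order3_mix fin_grpD(3) fin_grp_qnorm)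
  have iS: "i \<in> S" using fin_grpD(3)[OF max_grp_fin_grp[OF G]] iG .
  consider "G \<subseteq> {1, - 1, i, - i}" | "H \<subseteq> {1, - 1, i, - i}" | "Q G" "Q H" | "W G" "W H"
    using cases[OF G iG] cases[OF H iH] mix[OF _ max_grp_fin_grp[OF G] _ max_grp_fin_grp[OF H] iG]
      mix[OF _ max_grp_fin_grp[OF H] _ max_grp_fin_grp[OF G] iH] by blast
  then show ?thesis
  proof cases
    case 1
    then have "H = G" using max_grp_subset_eq[OF G max_grp_fin_grp[OF H]] C[OF H iH] by blast
    then show ?thesis by (simp add: conj_grp_refl)
  next
    case 2
    then have "G = H" using max_grp_subset_eq[OF H max_grp_fin_grp[OF G]] C[OF G iG] by blast
    then show ?thesis by (simp add: conj_grp_refl)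
  next
    case 3
    then obtain j j' where j: "j \<in> G" "j * j = - 1" "j * i = - (i * j)"
      and j': "j' \<in> H" "j' * j' = - 1" "j' * i = - (i * j')"
      unfolding Q_def by blast
    have S: "j \<in> S" "j' \<in> S"
      using fin_grpD(3) max_grp_fin_grp G H j(1) j'(1) by blast+
    have "j \<noteq> 0" using j(2) by auto
    then obtain u where u: "u \<in> S - {0}" "qconj u i = i" "qconj u j = j'"
      using conj_pure_fixing[OF iS ii S(1) j(3) S(2) j'(3)] j(2) j'(2) by metis
    let ?G = "qconj u ` G"
    have "i \<in> ?G" "j' \<in> ?G" using u iG j(1) by (metis imageI)+
    then have "?G = H"
      using max_grp_eq_hurwitz_units[OF max_grp_qconj[OF G u(1)] _ _ ii j'(2,3)]
        max_grp_eq_hurwitz_units[OF H iH j'(1) ii j'(2,3)] by simp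
    then show ?thesis using u(1) unfolding conj_grp_def by blast
  next
    case 4
    then obtain x y where x: "x \<in> G" "qre x = - 1 / 2" "qre (x * i) = 0"
      and y: "y \<in> H" "qre y = - 1 / 2" "qre (y * i) = 0"
      unfolding W_def by blast
    have S: "x \<in> S" "y \<in> S"
      using fin_grpD(3) max_grp_fin_grp G H x(1) y(1) by blast+
    have n: "qnorm x = 1" "qnorm y = 1"
      using fin_grp_qnorm max_grp_fin_grp G H x(1) y(1) by blast+
    define c :: quat where "c = (1 / 2) *\<^sub>R 1"
    note px = pure_part[OF ii x(2,3) n(1), folded c_def]
    note py = pure_part[OF ii y(2,3) n(2), folded c_def]
    have "c \<in> S" using of_real_mem[of "1 / 2"] by (simp add: c_def of_real_def)
    then obtain u where u: "u \<in> S - {0}" "qconj u i = i" "qconj u (x + c) = y + c"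
      using conj_pure_fixing[OF iS ii _ px(2) _ py(2)] S px(3,5) py(3) by (metis add_mem)
    have "qconj u c = c" using u(1) by (simp add: c_def qconj_scaleR)
    with u(3) have uy: "qconj u x = y" by (simp add: qconj_add)
    let ?G = "qconj u ` G"
    have i: "i \<in> ?G" and y': "y \<in> ?G" using u uy iG x(1) by (metis imageI)+
    have G': "max_grp ?G" using max_grp_qconj[OF G u(1)] .
    note hmult = fin_grpD(5)[OF max_grp_fin_grp[OF H]]
    \<comment> \<open>Type \<open>Q\<close> is excluded, so each g is a power of i or becomes y or y
      y after multiplication by one; all of these lie in H.\<close>
    have "?G \<subseteq> H"
    proof
      fix g assume g: "g \<in> ?G"
      have "\<not> Q ?G"
        using mix[OF _ max_grp_fin_grp[OF G'] _ max_grp_fin_grp[OF G'] i] y' y unfolding W_def by blast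
      then consider "g \<in> {1, - 1, i, - i}"
        | h where "h \<in> {1, - 1, i, - i}" "qre (g * h) = - 1 / 2" "qre (g * h * i) = 0"
        using fin_grp_order4_cases[OF max_grp_fin_grp[OF G'] i ii g] unfolding Q_def by blast
      then show "g \<in> H"
      proof cases
        case 1
        then show ?thesis using C[OF H iH] by blast
      next
        case (2 h)
        have hG: "h \<in> ?G" and hH: "h \<in> H" using C[OF G' i] C[OF H iH] 2(1) by blast+
        have "g * h \<in> ?G" using fin_grpD(5)[OF max_grp_fin_grp[OF G'] g hG] .
        then have "g * h = y \<or> g * h = y * y"
          using order3_unique[OF max_grp_fin_grp[OF G'] i ii y' y(2,3) _ 2(2,3)] by blast
        then have "g * h \<in> H" using y(1) hmult by auto
        then have "g * h * inverse h \<in> H"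
          using fin_grp_inverse[OF max_grp_fin_grp[OF H] hH] hmult by blast
        moreover have "h \<noteq> 0" using hH fin_grpD(4)[OF max_grp_fin_grp[OF H]] by blast
        ultimately show ?thesis by (simp add: mult.assoc)
      qed
    qed
    then have "H = ?G" using max_grp_subset_eq[OF G' max_grp_fin_grp[OF H]] by blast
    then show ?thesis using u(1) unfolding conj_grp_def by blast
  qed
qed

text \<open>\<open>conj_pure\<close> moves i to j except when j = -i, and then i already belongs to
  H.\<close>

lemma conj_grp_of_order4:
  assumes G: "max_grp G" and H: "max_grp H"
    and i: "i \<in> G" "i * i = - 1" and j: "j \<in> H" "j * j = - 1"
  shows "conj_grp G H"
proof (cases "j = - i")
  case True
  then have "i \<in> H" using max_grp_uminus[OF H j(1)] by simp
  then show ?thesis using conj_grp_of_common_order4[OF G H i(1) _ i(2)] by blast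
next
  case False
  have "i \<in> S" "j \<in> S" using fin_grpD(3) max_grp_fin_grp G H i(1) j(1) by blast+
  then obtain u where u: "u \<in> S - {0}" "qconj u i = j"
    using conj_pure[of i j] i(2) j(2) False by metis
  have "conj_grp (qconj u ` G) H"
    using conj_grp_of_common_order4[OF max_grp_qconj[OF G u(1)] H _ j(1,2)] u(2) i(1) by blast
  then show ?thesis using u(1) by (rule conj_grp_if_qconj[rotated])
qed

text \<open>From 1 + x + x x = 0 the traces of g, g x and g x x add up to 0. Three odd integers
  cannot do so, hence one trace is 0, giving a root of -1, or has size 2, giving 1 or -1.\<close>

lemma order3_cases:
  assumes G: "fin_grp G" and x: "x \<in> G" "qre x = - 1 / 2" and g: "g \<in> G"
  shows "(\<exists>i\<in>G. i * i = - 1) \<or> (\<exists>h\<in>{1, - 1}. g = h \<or> g = h * x \<or> g = h * (x * x))"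
proof -
  note mult = fin_grpD(5)[OF G]
  have xx: "x * x = - x - 1"
    using quat_char_poly[of x] x(2) fin_grp_qnorm[OF G x(1)] by simp
  then have xxx: "x * (x * x) = 1"
    by (simp add: right_diff_distrib)
  obtain r where r: "2 * qre g = of_int r" "r \<in> {-2, -1, 0, 1, 2}"
    "r = 2 \<longleftrightarrow> g = 1" "r = -2 \<longleftrightarrow> g = - 1"
    using fin_grp_trace[OF G g] .
  obtain s where s: "2 * qre (g * x) = of_int s" "s \<in> {-2, -1, 0, 1, 2}"
    "s = 2 \<longleftrightarrow> g * x = 1" "s = -2 \<longleftrightarrow> g * x = - 1"
    using fin_grp_trace[OF G mult[OF g x(1)]] .
  obtain t where t: "2 * qre (g * (x * x)) = of_int t" "t \<in> {-2, -1, 0, 1, 2}"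
    "t = 2 \<longleftrightarrow> g * (x * x) = 1" "t = -2 \<longleftrightarrow> g * (x * x) = - 1"
    using fin_grp_trace[OF G mult[OF g mult[OF x(1) x(1)]]] .
  have "2 * qre g + 2 * qre (g * x) + 2 * qre (g * (x * x)) = 0"
    unfolding xx by (simp add: right_diff_distrib)
  then have "real_of_int (r + s + t) = of_int 0" using r(1) s(1) t(1) by simp
  then have sum: "r + s + t = 0" unfolding of_int_eq_iff .
  have sq: "y * y = - 1" if "y \<in> G" "2 * qre y = of_int 0" for y
    using that fin_grp_qnorm[OF G] by (simp add: square_eq_neg_one_iff)
  consider "r = 0 \<or> s = 0 \<or> t = 0" | "\<bar>r\<bar> = 2 \<or> \<bar>s\<bar> = 2 \<or> \<bar>t\<bar> = 2"
    using sum r(2) s(2) t(2) by auto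
  then show ?thesis
  proof cases
    case 1
    then show ?thesis
      using sq g x(1) r(1) s(1) t(1) mult by metis
  next
    case 2
    have "g = h" if "g * (x * (x * x)) = h" for h
      using that by (simp add: xxx)
    then have *: "g = h * (x * x)" if "g * x = h" for h
      using that by (metis mult.assoc)
    have **: "g = h * x" if "g * (x * x) = h" for h
      using that xxx by (metis mult.assoc mult.right_neutral)
    from 2 have "\<exists>h\<in>{1, - 1}. g = h \<or> g * x = h \<or> g * (x * x) = h"
      using r s t by auto
    then show ?thesis using * ** by blast
  qed
qed

text \<open>The pure parts of x and y have the same square, so they can be matched unless they are
  opposite, and then x = y y lies in H anyway. With x shared, a group without a root of -1 consists
  of signed powers of x and lies in the other. If neither contains the other, both have such a
  root.\<close>

lemma conj_grp_of_order3:
  assumes G: "max_grp G" and H: "max_grp H"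
    and x: "x \<in> G" "qre x = - 1 / 2" and y: "y \<in> H" "qre y = - 1 / 2"
  shows "conj_grp G H"
proof -
  have sub: "{1, - 1} \<subseteq> K" if "max_grp K" for K
    using that fin_grpD(2)[OF max_grp_fin_grp] by (auto intro: max_grp_uminus)
  have common: "conj_grp K L" if K: "max_grp K" and L: "max_grp L" and x: "x \<in> K" "x \<in> L" "qre x = - 1 / 2" for K L x
  proof -
    have *: "(\<exists>i\<in>K. i * i = - 1) \<or> K \<subseteq> L" if K: "max_grp K" and L: "max_grp L" and x: "x \<in> K" "x \<in> L" for K L
    proof (cases "\<exists>i\<in>K. i * i = - 1")
      case False
      have "g \<in> L" if g: "g \<in> K" for g
      proof -
        obtain h where "h \<in> {1, - 1}" "g = h \<or> g = h * x \<or> g = h * (x * x)"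
          using order3_cases[OF max_grp_fin_grp[OF K] x(1) \<open>qre x = - 1 / 2\<close> g] False by blast
        moreover have "h \<in> L" using calculation(1) sub[OF L] by blast
        ultimately show ?thesis using x(2) fin_grpD(5)[OF max_grp_fin_grp[OF L]] by blast
      qed
      then show ?thesis by blast
    qed simp
    show ?thesis
    proof (cases "K \<subseteq> L \<or> L \<subseteq> K")
      case True
      then have "K = L"
        using max_grp_subset_eq[OF K max_grp_fin_grp[OF L]] max_grp_subset_eq[OF L max_grp_fin_grp[OF K]] by blast
      then show ?thesis by (simp add: conj_grp_refl)
    next
      case False
      then obtain i j where "i \<in> K" "i * i = - 1" "j \<in> L" "j * j = - 1"
        using *[OF K L x(1,2)] *[OF L K x(2,1)] by blast
      then show ?thesis using conj_grp_of_order4[OF K L] by blast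
    qed
  qed
  define c :: quat where "c = (1 / 2) *\<^sub>R 1"
  have S: "x \<in> S" "y \<in> S"
    using fin_grpD(3) max_grp_fin_grp G H x(1) y(1) by blast+
  have n: "qnorm x = 1" "qnorm y = 1"
    using fin_grp_qnorm max_grp_fin_grp G H x(1) y(1) by blast+
  have sq: "(z + c) * (z + c) = (- 3 / 4) *\<^sub>R 1" and sq': "z * z = - z - 1"
    if "qnorm z = 1" "qre z = - 1 / 2" for z
  proof -
    show zz: "z * z = - z - 1" using quat_char_poly[of z] that by simp
    show "(z + c) * (z + c) = (- 3 / 4) *\<^sub>R 1"
      by (simp add: distrib_left distrib_right zz) (simp add: c_def quat_eq_iff)
  qed
  have "c \<in> S" using of_real_mem[of "1 / 2"] by (simp add: c_def of_real_def)
  show ?thesis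
  proof (cases "y + c = - (x + c)")
    case True
    then have "x = - y - 1" by (simp add: c_def quat_eq_iff)
    then have "x = y * y" using sq'[OF n(2) y(2)] by simp
    then have "x \<in> H" using y(1) fin_grpD(5)[OF max_grp_fin_grp[OF H]] by blast
    then show ?thesis using common[OF G H x(1) _ x(2)] by blast
  next
    case False
    then obtain u where u: "u \<in> S - {0}" "qconj u (x + c) = y + c"
      using conj_pure[of "x + c" "y + c"] S \<open>c \<in> S\<close> sq[OF n(1) x(2)] sq[OF n(2) y(2)] by (metis add_mem)
    have "qconj u c = c" using u(1) by (simp add: c_def qconj_scaleR)
    with u(2) have "qconj u x = y" by (simp add: qconj_add)
    then have "conj_grp (qconj u ` G) H"
      using common[OF max_grp_qconj[OF G u(1)] H _ y(1,2)] x(1) by blast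
    then show ?thesis using u(1) by (rule conj_grp_if_qconj[rotated])
  qed
qed

lemma max_grp_cases:
  assumes G: "max_grp G"
  obtains "G = {1, - 1}" | i where "i \<in> G" "i * i = - 1" | x where "x \<in> G" "qre x = - 1 / 2"
proof (cases "G = {1, - 1}")
  case False
  note g = max_grp_fin_grp[OF G]
  have "{1, - 1} \<subseteq> G" using fin_grpD(2)[OF g] max_grp_uminus[OF G] by auto
  with False obtain x where x: "x \<in> G" "x \<noteq> 1" "x \<noteq> - 1" by blast
  obtain t :: int where t: "2 * qre x = of_int t" "t \<in> {-2, -1, 0, 1, 2}"
    "t = 2 \<longleftrightarrow> x = 1" "t = -2 \<longleftrightarrow> x = - 1"
    using fin_grp_trace[OF g x(1)] .
  then consider "t = 0" | "t = - 1" | "t = 1" using x by auto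
  then show ?thesis
  proof cases
    case 1
    then have "x * x = - 1" using t(1) fin_grp_qnorm[OF g x(1)] by (simp add: square_eq_neg_one_iff)
    then show ?thesis using that(2) x(1) by blast
  next
    case 2
    then show ?thesis using that(3) x(1) t(1) by simp
  next
    case 3
    then have "qre (- x) = - 1 / 2" using t(1) by simp
    then show ?thesis using that(3) max_grp_uminus[OF G x(1)] by blast
  qed
qed (use that in blast)

text \<open>Every maximal group contains {1, -1}, hence equals it if {1, -1} is maximal. Otherwise
  each of the three groups is of one of the two remaining types.\<close>

lemma two_of_three_conj:
  assumes "max_grp G" "max_grp H" "max_grp K"
  shows "conj_grp G H \<or> conj_grp G K \<or> conj_grp H K"
proof -
  have triv: "L = {1, - 1}" if "max_grp L" "max_grp {1, - 1}" for L
    using that max_grp_subset_eq[OF that(2) max_grp_fin_grp[OF that(1)]]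
      fin_grpD(2)[OF max_grp_fin_grp[OF that(1)]] max_grp_uminus[OF that(1)] by auto
  show ?thesis
  proof (cases "max_grp {1, - 1}")
    case True
    then have "G = H" using triv assms by blast
    then show ?thesis by (simp add: conj_grp_refl)
  next
    case False
    have "(\<exists>i\<in>L. i * i = - 1) \<or> (\<exists>x\<in>L. qre x = - 1 / 2)" if "max_grp L" for L
      using max_grp_cases[OF that] that False by metis
    then show ?thesis
      using conj_grp_of_order4 conj_grp_of_order3 assms by meson
  qed
qed

end

section \<open>Embedding a definite quaternion algebra into the real quaternions\<close>

lemma real_of_rat_abs: "real_of_rat \<bar>q\<bar> = \<bar>real_of_rat q\<bar>"
  by (simp add: abs_if of_rat_minus)

lemma cauchy_seq_abs_infinity:
  "cauchy_seq abs_infinity x \<longleftrightarrow> convergent (\<lambda>n. real_of_rat (x n))"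
  unfolding Cauchy_convergent_iff[symmetric]
  by (simp add: cauchy_seq_def abs_infinity_def real_of_rat_abs of_rat_diff Cauchy_def dist_real_def)

lemma null_seqs_abs_infinity:
  "null_seqs abs_infinity = {x. (\<lambda>n. real_of_rat (x n)) \<longlonglongrightarrow> 0}"
  unfolding null_seqs_def abs_infinity_def real_of_rat_abs tendsto_rabs_zero_iff ..

abbreviation real_ring :: "real ring"
  where "real_ring \<equiv> ring_of_type_algebra"

lemma cring_cauchy_seq_ring: "cring (cauchy_seq_ring abs_infinity)"
proof (rule cringI)
  show "abelian_group (cauchy_seq_ring abs_infinity)"
  proof (rule abelian_groupI)
    fix x assume "x \<in> carrier (cauchy_seq_ring abs_infinity)"
    then have "(\<lambda>n. - x n) \<in> carrier (cauchy_seq_ring abs_infinity)"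
      by (simp add: cauchy_seq_ring_def cauchy_seq_abs_infinity of_rat_minus flip: convergent_minus_iff)
    then show "\<exists>y\<in>carrier (cauchy_seq_ring abs_infinity).
        y \<oplus>\<^bsub>cauchy_seq_ring abs_infinity\<^esub> x = \<zero>\<^bsub>cauchy_seq_ring abs_infinity\<^esub>"
      by (rule bexI[rotated]) (simp add: cauchy_seq_ring_def)
  qed (auto simp: cauchy_seq_ring_def cauchy_seq_abs_infinity of_rat_add convergent_add
      convergent_const add_ac)
  show "comm_monoid (cauchy_seq_ring abs_infinity)"
    by (rule comm_monoidI)
      (auto simp: cauchy_seq_ring_def cauchy_seq_abs_infinity of_rat_mult convergent_mult
        convergent_const mult_ac)
qed (simp add: cauchy_seq_ring_def distrib_right)

text \<open>The null sequences are the kernel of the limit homomorphism into the real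
  numbers.\<close>

lemma ideal_null_seqs: "ideal (null_seqs abs_infinity) (cauchy_seq_ring abs_infinity)"
proof -
  let ?L = "\<lambda>x. lim (\<lambda>n. real_of_rat (x n))"
  interpret C: cring "cauchy_seq_ring abs_infinity" by (rule cring_cauchy_seq_ring)
  have lim: "(\<lambda>n. real_of_rat (x n)) \<longlonglongrightarrow> ?L x" if "x \<in> carrier (cauchy_seq_ring abs_infinity)" for x
    using that by (simp add: cauchy_seq_ring_def cauchy_seq_abs_infinity convergent_LIMSEQ_iff)
  have "ring_hom_ring (cauchy_seq_ring abs_infinity) real_ring ?L"
  proof (rule ring_hom_ringI)
    show "ring (cauchy_seq_ring abs_infinity)" by (rule C.ring_axioms)
    show "ring real_ring" by (rule ring_from_type_algebra)
  next
    fix x y assume xy: "x \<in> carrier (cauchy_seq_ring abs_infinity)" "y \<in> carrier (cauchy_seq_ring abs_infinity)"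
    show "?L (x \<otimes>\<^bsub>cauchy_seq_ring abs_infinity\<^esub> y) = ?L x \<otimes>\<^bsub>real_ring\<^esub> ?L y"
      using tendsto_mult[OF lim[OF xy(1)] lim[OF xy(2)]]
      by (simp add: cauchy_seq_ring_def ring_of_type_algebra_def of_rat_mult limI)
    show "?L (x \<oplus>\<^bsub>cauchy_seq_ring abs_infinity\<^esub> y) = ?L x \<oplus>\<^bsub>real_ring\<^esub> ?L y"
      using tendsto_add[OF lim[OF xy(1)] lim[OF xy(2)]]
      by (simp add: cauchy_seq_ring_def ring_of_type_algebra_def of_rat_add limI)
  qed (auto simp: cauchy_seq_ring_def ring_of_type_algebra_def)
  then have "ideal (a_kernel (cauchy_seq_ring abs_infinity) real_ring ?L) (cauchy_seq_ring abs_infinity)"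
    by (rule ring_hom_ring.kernel_is_ideal)
  moreover have "a_kernel (cauchy_seq_ring abs_infinity) real_ring ?L = null_seqs abs_infinity"
  proof (intro Set.set_eqI iffI)
    fix x assume "x \<in> a_kernel (cauchy_seq_ring abs_infinity) real_ring ?L"
    then have "x \<in> carrier (cauchy_seq_ring abs_infinity)" "?L x = 0"
      by (auto simp: a_kernel_def' ring_of_type_algebra_def)
    then show "x \<in> null_seqs abs_infinity"
      using lim[of x] by (simp add: null_seqs_abs_infinity)
  next
    fix x assume "x \<in> null_seqs abs_infinity"
    then show "x \<in> a_kernel (cauchy_seq_ring abs_infinity) real_ring ?L"
      by (auto simp: a_kernel_def' null_seqs_abs_infinity ring_of_type_algebra_def cauchy_seq_ring_def
          cauchy_seq_abs_infinity convergent_def limI)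
  qed
  ultimately show ?thesis by simp
qed

lemma rat_seq_converging_to: obtains x :: "nat \<Rightarrow> rat" where "(\<lambda>n. real_of_rat (x n)) \<longlonglongrightarrow> r"
proof -
  have "\<exists>q. \<bar>real_of_rat q - r\<bar> < inverse (real (Suc n))" for n
  proof -
    have "r < r + inverse (real (Suc n))" by simp
    then obtain q where "r < real_of_rat q" "real_of_rat q < r + inverse (real (Suc n))"
      using of_rat_dense by blast
    then show ?thesis by (intro exI[of _ q]) simp
  qed
  then obtain x where x: "\<And>n. \<bar>real_of_rat (x n) - r\<bar> < inverse (real (Suc n))" by metis
  have "(\<lambda>n. real_of_rat (x n) - r) \<longlonglongrightarrow> 0"
    using x by (intro LIMSEQ_norm_0) (simp add: divide_inverse)
  then show ?thesis by (rule that[OF LIM_zero_cancel])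
qed

text \<open>A rational sequence tending to the real square root of a represents e: its square
  differs from the constant a by a null sequence.\<close>

lemma completion_sqrt:
  assumes "a > 0"
  shows "\<exists>e\<in>carrier (completion abs_infinity).
    e \<otimes>\<^bsub>completion abs_infinity\<^esub> e = completion_embed abs_infinity a"
proof -
  let ?C = "cauchy_seq_ring abs_infinity" and ?I = "null_seqs abs_infinity"
  interpret C: cring ?C by (rule cring_cauchy_seq_ring)
  obtain x where x: "(\<lambda>n. real_of_rat (x n)) \<longlonglongrightarrow> sqrt (real_of_rat a)"
    using rat_seq_converging_to .
  then have xC: "x \<in> carrier ?C"
    by (auto simp: cauchy_seq_ring_def cauchy_seq_abs_infinity convergent_def)
  have aC: "(\<lambda>_. a) \<in> carrier ?C"
    by (simp add: cauchy_seq_ring_def cauchy_seq_abs_infinity convergent_const)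
  have nC: "(\<lambda>_. - a) \<in> carrier ?C"
    by (simp add: cauchy_seq_ring_def cauchy_seq_abs_infinity convergent_const)
  have "\<ominus>\<^bsub>?C\<^esub> (\<lambda>_. a) = (\<lambda>_. - a)"
    using aC nC by (intro C.minus_equality) (auto simp: cauchy_seq_ring_def)
  then have "x \<otimes>\<^bsub>?C\<^esub> x \<ominus>\<^bsub>?C\<^esub> (\<lambda>_. a) = (\<lambda>n. x n * x n - a)"
    by (simp add: a_minus_def) (simp add: cauchy_seq_ring_def)
  moreover have "(\<lambda>n. x n * x n - a) \<in> ?I"
    using tendsto_diff[OF tendsto_mult[OF x x] tendsto_const[of "real_of_rat a"]] assms
    by (simp add: null_seqs_abs_infinity of_rat_diff of_rat_mult)
  ultimately have "?I +>\<^bsub>?C\<^esub> (x \<otimes>\<^bsub>?C\<^esub> x) = ?I +>\<^bsub>?C\<^esub> (\<lambda>_. a)"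
    using C.quotient_eq_iff_same_a_r_cos[OF ideal_null_seqs C.m_closed[OF xC xC] aC] by simp
  then show ?thesis
    using ring_hom_memE(1,2)[OF ideal.rcos_ring_hom[OF ideal_null_seqs]] xC
    unfolding completion_def completion_embed_def by metis
qed

text \<open>If e e = a, then (-e + i) (e + i) = 0 exhibits zero divisors; likewise with j for
  b.\<close>

lemma quaternion_ring_split:
  assumes K: "cring K" and e: "e \<in> carrier K" and ab: "a \<in> carrier K" "b \<in> carrier K"
    and sq: "e \<otimes>\<^bsub>K\<^esub> e = a \<or> e \<otimes>\<^bsub>K\<^esub> e = b"
  shows "\<not> is_division_algebra (quaternion_ring K a b)"
proof
  let ?Q = "quaternion_ring K a b"
  interpret K: cring K by (rule K)
  assume div: "is_division_algebra ?Q"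
  interpret Q: ring ?Q using div by (simp add: is_division_algebra_def)
  have 10: "\<one>\<^bsub>K\<^esub> \<noteq> \<zero>\<^bsub>K\<^esub>"
    using div by (auto simp: is_division_algebra_def quaternion_ring_def)
  have no_zero_div: "u \<otimes>\<^bsub>?Q\<^esub> v \<noteq> \<zero>\<^bsub>?Q\<^esub>"
    if "u \<in> carrier ?Q - {\<zero>\<^bsub>?Q\<^esub>}" "v \<in> carrier ?Q - {\<zero>\<^bsub>?Q\<^esub>}" for u v
  proof
    assume 0: "u \<otimes>\<^bsub>?Q\<^esub> v = \<zero>\<^bsub>?Q\<^esub>"
    have u: "u \<in> Units ?Q" using that div by (simp add: is_division_algebra_def)
    have "v = inv\<^bsub>?Q\<^esub> u \<otimes>\<^bsub>?Q\<^esub> (u \<otimes>\<^bsub>?Q\<^esub> v)"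
      using u that by (simp flip: Q.m_assoc)
    also have "\<dots> = \<zero>\<^bsub>?Q\<^esub>" using u 0 by simp
    finally show False using that by simp
  qed
  from sq show False
  proof
    assume sq: "e \<otimes>\<^bsub>K\<^esub> e = a"
    have "(\<ominus>\<^bsub>K\<^esub> e, \<one>\<^bsub>K\<^esub>, \<zero>\<^bsub>K\<^esub>, \<zero>\<^bsub>K\<^esub>) \<otimes>\<^bsub>?Q\<^esub> (e, \<one>\<^bsub>K\<^esub>, \<zero>\<^bsub>K\<^esub>, \<zero>\<^bsub>K\<^esub>) = \<zero>\<^bsub>?Q\<^esub>"
      using e ab sq[symmetric]
      by (simp add: quaternion_ring_def K.minus_eq K.l_minus K.l_neg)
    then show False
      using no_zero_div[of "(\<ominus>\<^bsub>K\<^esub> e, \<one>\<^bsub>K\<^esub>, \<zero>\<^bsub>K\<^esub>, \<zero>\<^bsub>K\<^esub>)" "(e, \<one>\<^bsub>K\<^esub>, \<zero>\<^bsub>K\<^esub>, \<zero>\<^bsub>K\<^esub>)"] e 10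
      by (simp add: quaternion_ring_def)
  next
    assume sq: "e \<otimes>\<^bsub>K\<^esub> e = b"
    have "(\<ominus>\<^bsub>K\<^esub> e, \<zero>\<^bsub>K\<^esub>, \<one>\<^bsub>K\<^esub>, \<zero>\<^bsub>K\<^esub>) \<otimes>\<^bsub>?Q\<^esub> (e, \<zero>\<^bsub>K\<^esub>, \<one>\<^bsub>K\<^esub>, \<zero>\<^bsub>K\<^esub>) = \<zero>\<^bsub>?Q\<^esub>"
      using e ab sq[symmetric]
      by (simp add: quaternion_ring_def K.minus_eq K.l_minus K.l_neg)
    then show False
      using no_zero_div[of "(\<ominus>\<^bsub>K\<^esub> e, \<zero>\<^bsub>K\<^esub>, \<one>\<^bsub>K\<^esub>, \<zero>\<^bsub>K\<^esub>)" "(e, \<zero>\<^bsub>K\<^esub>, \<one>\<^bsub>K\<^esub>, \<zero>\<^bsub>K\<^esub>)"] e 10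
      by (simp add: quaternion_ring_def)
  qed
qed

text \<open>A positive a or b becomes a square in the completion and would split the algebra
  there.\<close>

lemma ramified_at_infinity_definite:
  assumes "ramified_at abs_infinity D"
  obtains a b where "rat_quaternion_symbol D a b" "a < 0" "b < 0"
proof -
  let ?K = "completion abs_infinity" and ?\<iota> = "completion_embed abs_infinity"
  obtain a b where ab: "rat_quaternion_symbol D a b"
      "is_division_algebra (quaternion_ring ?K (?\<iota> a) (?\<iota> b))"
    using assms unfolding ramified_at_def by blast
  have K: "cring ?K"
    unfolding completion_def using ideal_null_seqs cring_cauchy_seq_ring by (rule ideal.quotient_is_cring)
  have \<iota>: "?\<iota> q \<in> carrier ?K" for q
    using ring_hom_memE(1)[OF ideal.rcos_ring_hom[OF ideal_null_seqs], of "\<lambda>_. q"]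
    by (simp add: completion_def completion_embed_def cauchy_seq_ring_def cauchy_seq_abs_infinity convergent_const)
  have "\<not> 0 < a" "\<not> 0 < b"
    using quaternion_ring_split[OF K _ \<iota> \<iota>] completion_sqrt ab(2) by metis+
  moreover have "a \<noteq> 0" "b \<noteq> 0" using ab(1) by (simp_all add: rat_quaternion_symbol_def)
  ultimately show ?thesis using that ab(1) by force
qed

text \<open>For negative a, b the generators go to real multiples of the standard i and j, scaled so
  that their squares are a and b. The real part stays rational.\<close>

definition quat_of_tuple :: "rat \<Rightarrow> rat \<Rightarrow> rat \<times> rat \<times> rat \<times> rat \<Rightarrow> quat"
  where "quat_of_tuple a b = (\<lambda>(x0, x1, x2, x3).
    Quat (of_rat x0) (of_rat x1 * sqrt (- of_rat a)) (of_rat x2 * sqrt (- of_rat b))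
      (of_rat x3 * (sqrt (- of_rat a) * sqrt (- of_rat b))))"

lemma a_inv_rat_ring: "\<ominus>\<^bsub>rat_ring\<^esub> x = - x"
proof -
  interpret ring rat_ring by (rule ring_from_type_algebra)
  show ?thesis by (rule minus_equality) (simp_all add: ring_of_type_algebra_def)
qed

lemma quat_of_tuple_mult:
  assumes "a < 0" "b < 0"
  shows "quat_of_tuple a b (x \<otimes>\<^bsub>quaternion_ring rat_ring a b\<^esub> y) = quat_of_tuple a b x * quat_of_tuple a b y"
proof -
  have a: "sqrt (- of_rat a) * sqrt (- of_rat a) = - of_rat a" "sqrt (- of_rat b) * sqrt (- of_rat b) = - of_rat b"
    using assms by (simp_all add: of_rat_minus)
  have a': "sqrt (- of_rat a) * (sqrt (- of_rat a) * z) = - of_rat a * z"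
    "sqrt (- of_rat b) * (sqrt (- of_rat b) * z) = - of_rat b * z" for z
    using a by (simp_all add: mult.assoc[symmetric] del: real_sqrt_mult_self)
  obtain x0 x1 x2 x3 y0 y1 y2 y3 where "x = (x0, x1, x2, x3)" "y = (y0, y1, y2, y3)"
    by (cases x; cases y) auto
  then show ?thesis
    by (simp add: quat_eq_iff quat_mult_sel quat_of_tuple_def quaternion_ring_def a_minus_def a_inv_rat_ring)
      (simp add: ring_of_type_algebra_def of_rat_add of_rat_mult of_rat_minus of_rat_diff algebra_simps a a'
        del: real_sqrt_mult_self)
qed

lemma quat_of_tuple_inj:
  assumes "a < 0" "b < 0"
  shows "inj (quat_of_tuple a b)"
proof (rule injI)
  fix x y assume eq: "quat_of_tuple a b x = quat_of_tuple a b y"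
  obtain x0 x1 x2 x3 y0 y1 y2 y3 where "x = (x0, x1, x2, x3)" "y = (y0, y1, y2, y3)"
    by (cases x; cases y) auto
  then show "x = y"
    using eq assms by (simp add: quat_of_tuple_def)
qed

lemma rat_quat_algebra_range:
  assumes ab: "a < 0" "b < 0"
  shows "rat_quat_algebra (range (quat_of_tuple a b))"
proof
  let ?S = "range (quat_of_tuple a b)"
  have memI: "Quat (of_rat x0) (of_rat x1 * sqrt (- of_rat a)) (of_rat x2 * sqrt (- of_rat b))
      (of_rat x3 * (sqrt (- of_rat a) * sqrt (- of_rat b))) \<in> ?S" for x0 x1 x2 x3
    by (rule range_eqI[of _ _ "(x0, x1, x2, x3)"]) (simp add: quat_of_tuple_def)
  show "1 \<in> ?S"
    using memI[of 1 0 0 0] by (simp add: one_quat_def)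
  fix x assume "x \<in> ?S"
  then obtain x0 x1 x2 x3 where x: "x = quat_of_tuple a b (x0, x1, x2, x3)" by auto
  show "qre x \<in> \<rat>" by (simp add: x quat_of_tuple_def)
  \<comment> \<open>The reduced norm form of (a, b). The square roots enter it only squared, so n is
    rational and division by it keeps the inverse in the range.\<close>
  define n where "n = x0\<^sup>2 - a * x1\<^sup>2 - b * x2\<^sup>2 + a * b * x3\<^sup>2"
  have "qnorm x = of_rat n"
    using ab by (simp add: n_def x quat_of_tuple_def qnorm_def power_mult_distrib of_rat_add of_rat_diff
        of_rat_mult of_rat_power real_sqrt_pow2)
  then show "inverse x \<in> ?S"
    using memI[of "x0 / n" "- x1 / n" "- x2 / n" "- x3 / n"]
    by (simp add: inverse_quat_def Let_def x quat_of_tuple_def of_rat_divide of_rat_minus)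
  fix y assume "y \<in> ?S"
  then obtain y0 y1 y2 y3 where y: "y = quat_of_tuple a b (y0, y1, y2, y3)" by auto
  show "x - y \<in> ?S"
    using memI[of "x0 - y0" "x1 - y1" "x2 - y2" "x3 - y3"]
    by (simp add: minus_quat_def x y quat_of_tuple_def of_rat_diff left_diff_distrib)
  show "x * y \<in> ?S"
    unfolding x y quat_of_tuple_mult[OF ab, symmetric] by (rule rangeI)
qed

lemma definite_quaternion_embedding:
  assumes "ramified_at abs_infinity D"
  obtains \<phi> :: "'d \<Rightarrow> quat" where "rat_quat_algebra (\<phi> ` carrier (D :: ('d, 'm) ring_scheme))"
    "inj_on \<phi> (carrier D)" "\<phi> \<one>\<^bsub>D\<^esub> = 1"
    "\<And>x y. x \<in> carrier D \<Longrightarrow> y \<in> carrier D \<Longrightarrow> \<phi> (x \<otimes>\<^bsub>D\<^esub> y) = \<phi> x * \<phi> y"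
proof -
  obtain a b where ab: "rat_quaternion_symbol D a b" "a < 0" "b < 0"
    using ramified_at_infinity_definite[OF assms] .
  let ?Q = "quaternion_ring rat_ring a b"
  have Q: "carrier ?Q = UNIV" "\<one>\<^bsub>?Q\<^esub> = (1, 0, 0, 0)"
    by (simp_all add: quaternion_ring_def ring_of_type_algebra_def)
  obtain h where h: "h \<in> ring_iso D ?Q"
    using ab(1) unfolding rat_quaternion_symbol_def is_ring_iso_def by blast
  define \<phi> where "\<phi> = quat_of_tuple a b \<circ> h"
  have "h ` carrier D = UNIV" "inj_on h (carrier D)"
    using ring_iso_memE(5)[OF h] Q(1) by (auto simp: bij_betw_def)
  then have "rat_quat_algebra (\<phi> ` carrier D)" "inj_on \<phi> (carrier D)"
    using rat_quat_algebra_range[OF ab(2,3)] quat_of_tuple_inj[OF ab(2,3)]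
    unfolding \<phi>_def by (auto simp flip: image_image intro: comp_inj_on inj_on_subset)
  moreover have "\<phi> \<one>\<^bsub>D\<^esub> = 1"
    using ring_iso_memE(4)[OF h] by (simp add: \<phi>_def Q(2) quat_of_tuple_def one_quat_def)
  moreover have "\<phi> (x \<otimes>\<^bsub>D\<^esub> y) = \<phi> x * \<phi> y" if "x \<in> carrier D" "y \<in> carrier D" for x y
    using ring_iso_memE(2)[OF h] that by (simp add: \<phi>_def quat_of_tuple_mult[OF ab(2,3)])
  ultimately show ?thesis by (rule that)
qed

section \<open>Transfer to the unit group of D\<close>

definition conj_by_unit :: "('a, 'm) monoid_scheme \<Rightarrow> 'a set \<Rightarrow> 'a set \<Rightarrow> bool"
  where "conj_by_unit R G H \<longleftrightarrow> (\<exists>u\<in>Units R. H = (\<lambda>x. u \<otimes>\<^bsub>R\<^esub> x \<otimes>\<^bsub>R\<^esub> inv\<^bsub>R\<^esub> u) ` G)"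

text \<open>\<open>\<phi>\<close> is injective and multiplicative with an image closed under
  inverses, so units, maximality and conjugacy can be moved between D and the image.\<close>

lemma two_of_three_conj_units:
  fixes D (structure)
  assumes "ring D" and "ramified_at abs_infinity D"
    and G: "maximal_finite_subgroup G1 (units_of D)" "maximal_finite_subgroup G2 (units_of D)"
      "maximal_finite_subgroup G3 (units_of D)"
  shows "conj_by_unit D G1 G2 \<or> conj_by_unit D G1 G3 \<or> conj_by_unit D G2 G3"
proof -
  interpret D: ring D by fact
  interpret U: group "units_of D" by (rule D.units_group)
  obtain \<phi> where S: "rat_quat_algebra (\<phi> ` carrier D)" and inj: "inj_on \<phi> (carrier D)"
    and one: "\<phi> \<one> = 1" and mult: "\<And>x y. x \<in> carrier D \<Longrightarrow> y \<in> carrier D \<Longrightarrow> \<phi> (x \<otimes> y) = \<phi> x * \<phi> y"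
    using definite_quaternion_embedding[OF assms(2)] by blast
  interpret S: rat_quat_algebra "\<phi> ` carrier D" by (rule S)
  have unit0: "\<phi> x \<noteq> 0" if "x \<in> Units D" for x
  proof
    assume "\<phi> x = 0"
    then have "\<phi> (x \<otimes> inv x) = 0"
      using that by (subst mult) (auto simp: D.Units_closed)
    then show False using that one by simp
  qed
  have unit: "x \<in> Units D" "inverse (\<phi> x) = \<phi> (inv x)" if x: "x \<in> carrier D" "\<phi> x \<noteq> 0" for x
  proof -
    obtain y where y: "y \<in> carrier D" "inverse (\<phi> x) = \<phi> y" using S.inverse_mem x(1) by blast
    then have "\<phi> (x \<otimes> y) = \<phi> \<one>" "\<phi> (y \<otimes> x) = \<phi> \<one>"
      using x mult one by (simp_all flip: y(2))
    then have xy: "x \<otimes> y = \<one>" "y \<otimes> x = \<one>"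
      using inj x y by (auto dest: inj_onD)
    then show "x \<in> Units D" using x y unfolding Units_def by blast
    then show "inverse (\<phi> x) = \<phi> (inv x)"
      using y(2) D.inv_unique'[OF x(1) y(1) xy] by simp
  qed
  have max: "S.max_grp (\<phi> ` G)" if G: "maximal_finite_subgroup G (units_of D)" for G
    unfolding S.max_grp_def
  proof (intro conjI allI impI)
    have sub: "subgroup G (units_of D)" and fin: "finite G"
      using G unfolding maximal_finite_subgroup_def by auto
    then have GU: "G \<subseteq> Units D" using subgroup.subset by (fastforce simp: units_of_carrier)
    then have GD: "G \<subseteq> carrier D" using D.Units_closed by blast
    show "S.fin_grp (\<phi> ` G)"
      unfolding S.fin_grp_def
    proof (intro conjI ballI)
      show "finite (\<phi> ` G)" using fin by simp
      have "\<phi> x \<in> \<phi> ` carrier D - {0}" if "x \<in> G" for x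
        using that GU GD unit0[of x] by auto
      then show "\<phi> ` G \<subseteq> \<phi> ` carrier D - {0}" by (rule image_subsetI)
      show "1 \<in> \<phi> ` G" using subgroup.one_closed[OF sub] one by (auto simp: units_of_one)
      fix x y assume "x \<in> \<phi> ` G" "y \<in> \<phi> ` G"
      then show "x * y \<in> \<phi> ` G"
        using subgroup.m_closed[OF sub] mult GD by (auto simp: units_of_mult image_iff) (metis subsetD)
    qed
    fix K assume K: "S.fin_grp K \<and> \<phi> ` G \<subseteq> K"
    \<comment> \<open>K lies in the image of \<open>\<phi>\<close>, so its preimage is a finite
      group of units that maps onto it, and maximality of G applies.\<close>
    define H where "H = {x \<in> carrier D. \<phi> x \<in> K}"
    have KH: "\<phi> ` H = K" using K S.fin_grpD(3) by (auto simp: H_def)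
    have "0 \<notin> K" using K S.fin_grpD(4) by blast
    then have "x \<in> Units D" if "x \<in> H" for x
      using that unit(1)[of x] by (cases "\<phi> x = 0") (auto simp: H_def)
    then have HU: "H \<subseteq> Units D" by blast
    have "subgroup H (units_of D)"
    proof (rule U.subgroupI)
      show "H \<subseteq> carrier (units_of D)" using HU by (simp add: units_of_carrier)
      show "H \<noteq> {}" using KH K S.fin_grpD(2) by auto
    next
      fix x assume x: "x \<in> H"
      then have "x \<in> Units D" using HU by blast
      then have "inverse (\<phi> x) = \<phi> (inv x)" "inv x \<in> carrier D"
        using unit(2) unit0 by (auto simp: D.Units_closed)
      then show "inv\<^bsub>units_of D\<^esub> x \<in> H"
        using x \<open>x \<in> Units D\<close> S.fin_grp_inverse K by (fastforce simp: H_def D.units_of_inv)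
    next
      fix x y assume "x \<in> H" "y \<in> H"
      then show "x \<otimes>\<^bsub>units_of D\<^esub> y \<in> H"
        using K S.fin_grpD(5) by (auto simp: H_def units_of_mult mult)
    qed
    moreover have "finite H"
      using KH K S.fin_grpD(1) inj finite_imageD[of \<phi> H] inj_on_subset[of \<phi> "carrier D" H] by (auto simp: H_def)
    moreover have "G \<subseteq> H" using K GD by (auto simp: H_def)
    ultimately have "H = G" using G unfolding maximal_finite_subgroup_def by blast
    then show "K = \<phi> ` G" using KH by simp
  qed
  have conj: "conj_by_unit D G H"
    if GH: "S.conj_grp (\<phi> ` G) (\<phi> ` H)" and mG: "maximal_finite_subgroup G (units_of D)"
      and mH: "maximal_finite_subgroup H (units_of D)" for G H
  proof -
    have sub: "G \<subseteq> carrier D" "H \<subseteq> carrier D"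
      using mG mH D.Units_closed subgroup.subset unfolding maximal_finite_subgroup_def
      by (fastforce simp: units_of_carrier)+
    obtain u where u: "u \<in> carrier D" "\<phi> u \<noteq> 0" "\<phi> ` H = qconj (\<phi> u) ` \<phi> ` G"
      using GH unfolding S.conj_grp_def by blast
    note uu = unit[OF u(1,2)]
    have eq: "\<phi> ` H = \<phi> ` (\<lambda>x. u \<otimes> x \<otimes> inv u) ` G"
      unfolding u(3) image_image
      using sub(1) u(1) uu by (intro image_cong) (auto simp: qconj_def mult D.Units_closed subset_iff)
    have sub': "(\<lambda>x. u \<otimes> x \<otimes> inv u) ` G \<subseteq> carrier D"
      using sub(1) u(1) uu(1) by auto
    from eq have "H = (\<lambda>x. u \<otimes> x \<otimes> inv u) ` G"
      by (rule inj_on_image_eq_iff[OF inj sub(2) sub', THEN iffD1])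
    then show ?thesis using uu(1) unfolding conj_by_unit_def by blast
  qed
  show ?thesis
    using S.two_of_three_conj[OF max[OF G(1)] max[OF G(2)] max[OF G(3)]] conj G by blast
qed

section \<open>Monomial matrices and block diagonal groups\<close>

lemma matrix_ring_simps:
  "carrier (matrix_ring n D) = {..<n} \<times> {..<n} \<rightarrow>\<^sub>E carrier D"
  "A \<otimes>\<^bsub>matrix_ring n D\<^esub> B =
    (\<lambda>(i, k)\<in>{..<n} \<times> {..<n}. \<Oplus>\<^bsub>D\<^esub>j\<in>{..<n}. A (i, j) \<otimes>\<^bsub>D\<^esub> B (j, k))"
  "\<one>\<^bsub>matrix_ring n D\<^esub> = (\<lambda>(i, k)\<in>{..<n} \<times> {..<n}. if i = k then \<one>\<^bsub>D\<^esub> else \<zero>\<^bsub>D\<^esub>)"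
  by (simp_all add: matrix_ring_def)

text \<open>Row i has at most one nonzero entry, in column \<open>\<pi> i\<close>. This covers both
  the diagonal matrices and the swap of two blocks.\<close>

definition monomial_matrix ::
  "nat \<Rightarrow> ('d, 'm) ring_scheme \<Rightarrow> (nat \<Rightarrow> nat) \<Rightarrow> (nat \<Rightarrow> 'd) \<Rightarrow> nat \<times> nat \<Rightarrow> 'd"
  where "monomial_matrix n D \<pi> d = (\<lambda>(i, k)\<in>{..<n} \<times> {..<n}. if k = \<pi> i then d i else \<zero>\<^bsub>D\<^esub>)"

section \<open>Multiplication of matrices over a ring\<close>

context ring
begin

lemma finsum_swap:
  assumes "finite A" "finite B" "\<And>i j. i \<in> A \<Longrightarrow> j \<in> B \<Longrightarrow> f i j \<in> carrier R"
  shows "(\<Oplus>i\<in>A. \<Oplus>j\<in>B. f i j) = (\<Oplus>j\<in>B. \<Oplus>i\<in>A. f i j)"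
  using assms(1,3)
proof (induction A rule: finite_induct)
  case empty
  then show ?case by simp
next
  case (insert a A)
  then have c: "f a \<in> B \<rightarrow> carrier R" "(\<lambda>j. \<Oplus>i\<in>A. f i j) \<in> B \<rightarrow> carrier R"
    "(\<lambda>i. \<Oplus>j\<in>B. f i j) \<in> A \<rightarrow> carrier R" "(\<Oplus>j\<in>B. f a j) \<in> carrier R"
    by (auto intro!: finsum_closed)
  have "(\<Oplus>i\<in>insert a A. \<Oplus>j\<in>B. f i j) = (\<Oplus>j\<in>B. f a j) \<oplus> (\<Oplus>j\<in>B. \<Oplus>i\<in>A. f i j)"
    using insert c by (simp add: finsum_insert)
  also have "\<dots> = (\<Oplus>j\<in>B. f a j \<oplus> (\<Oplus>i\<in>A. f i j))"
    using c by (simp add: finsum_addf)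
  also have "\<dots> = (\<Oplus>j\<in>B. \<Oplus>i\<in>insert a A. f i j)"
    using insert by (intro finsum_cong') (auto simp: finsum_insert intro!: finsum_closed)
  finally show ?case .
qed

lemma finsum_delta:
  assumes "finite A" "i \<in> A" "f i \<in> carrier R"
  shows "(\<Oplus>j\<in>A. if j = i then f j else \<zero>) = f i"
proof -
  have "(\<Oplus>j\<in>A. if j = i then f j else \<zero>) = (\<Oplus>j\<in>A. if i = j then f i else \<zero>)"
    using assms by (intro finsum_cong') auto
  also have "\<dots> = f i"
    using finsum_singleton[of i A "\<lambda>_. f i"] assms by simp
  finally show ?thesis .
qed

lemma matrix_ring_closed:
  assumes "A \<in> carrier (matrix_ring n R)" "i < n" "j < n"
  shows "A (i, j) \<in> carrier R"
  using assms by (auto simp: matrix_ring_simps)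

lemma matrix_ring_monoid: "monoid (matrix_ring n R)"
proof (rule monoidI)
  let ?M = "matrix_ring n R"
  note closed = matrix_ring_closed
  fix A B assume A: "A \<in> carrier ?M" and B: "B \<in> carrier ?M"
  show AB: "A \<otimes>\<^bsub>?M\<^esub> B \<in> carrier ?M"
    using closed[OF A] closed[OF B] by (auto simp: matrix_ring_simps intro!: finsum_closed)
  fix C assume C: "C \<in> carrier ?M"
  show "A \<otimes>\<^bsub>?M\<^esub> B \<otimes>\<^bsub>?M\<^esub> C = A \<otimes>\<^bsub>?M\<^esub> (B \<otimes>\<^bsub>?M\<^esub> C)"
  proof
    fix ik :: "nat \<times> nat"
    obtain i k where ik: "ik = (i, k)" by (cases ik)
    show "(A \<otimes>\<^bsub>?M\<^esub> B \<otimes>\<^bsub>?M\<^esub> C) ik = (A \<otimes>\<^bsub>?M\<^esub> (B \<otimes>\<^bsub>?M\<^esub> C)) ik"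
    proof (cases "i < n \<and> k < n")
      case True
      have "(A \<otimes>\<^bsub>?M\<^esub> B \<otimes>\<^bsub>?M\<^esub> C) ik = (\<Oplus>l\<in>{..<n}. (\<Oplus>j\<in>{..<n}. A (i, j) \<otimes> B (j, l)) \<otimes> C (l, k))"
        using True closed[OF A] closed[OF B] closed[OF C]
        by (auto simp: matrix_ring_simps ik intro!: finsum_cong' finsum_closed)
      also have "\<dots> = (\<Oplus>l\<in>{..<n}. \<Oplus>j\<in>{..<n}. A (i, j) \<otimes> B (j, l) \<otimes> C (l, k))"
        using True closed[OF A] closed[OF B] closed[OF C]
        by (intro finsum_cong' finsum_ldistr) (auto intro!: finsum_closed)
      also have "\<dots> = (\<Oplus>j\<in>{..<n}. \<Oplus>l\<in>{..<n}. A (i, j) \<otimes> B (j, l) \<otimes> C (l, k))"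
        using True closed[OF A] closed[OF B] closed[OF C] by (intro finsum_swap) auto
      also have "\<dots> = (\<Oplus>j\<in>{..<n}. \<Oplus>l\<in>{..<n}. A (i, j) \<otimes> (B (j, l) \<otimes> C (l, k)))"
        using True closed[OF A] closed[OF B] closed[OF C]
        by (intro finsum_cong') (auto simp: m_assoc intro!: finsum_closed)
      also have "\<dots> = (\<Oplus>j\<in>{..<n}. A (i, j) \<otimes> (\<Oplus>l\<in>{..<n}. B (j, l) \<otimes> C (l, k)))"
        using True closed[OF A] closed[OF B] closed[OF C]
        by (intro finsum_cong' finsum_rdistr[symmetric]) (auto intro!: finsum_closed)
      also have "\<dots> = (A \<otimes>\<^bsub>?M\<^esub> (B \<otimes>\<^bsub>?M\<^esub> C)) ik"
        using True closed[OF A] closed[OF B] closed[OF C]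
        by (auto simp: matrix_ring_simps ik intro!: finsum_cong' finsum_closed)
      finally show ?thesis .
    qed (auto simp: matrix_ring_simps ik)
  qed
next
  let ?M = "matrix_ring n R"
  show "\<one>\<^bsub>?M\<^esub> \<in> carrier ?M" by (auto simp: matrix_ring_simps)
  fix A assume A: "A \<in> carrier ?M"
  note closed = matrix_ring_closed[OF A]
  have ext: "A (i, k) = undefined" if "\<not> (i < n \<and> k < n)" for i k
    using A that by (auto simp: matrix_ring_simps PiE_def extensional_def)
  show "\<one>\<^bsub>?M\<^esub> \<otimes>\<^bsub>?M\<^esub> A = A"
  proof
    fix ik :: "nat \<times> nat"
    obtain i k where ik: "ik = (i, k)" by (cases ik)
    show "(\<one>\<^bsub>?M\<^esub> \<otimes>\<^bsub>?M\<^esub> A) ik = A ik"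
    proof (cases "i < n \<and> k < n")
      case True
      then have "(\<one>\<^bsub>?M\<^esub> \<otimes>\<^bsub>?M\<^esub> A) ik = (\<Oplus>j\<in>{..<n}. if j = i then A (j, k) else \<zero>)"
        using closed by (auto simp: matrix_ring_simps ik intro!: finsum_cong')
      also have "\<dots> = A ik"
        unfolding ik using True closed by (intro finsum_delta) auto
      finally show ?thesis .
    qed (auto simp: matrix_ring_simps ik ext)
  qed
  show "A \<otimes>\<^bsub>?M\<^esub> \<one>\<^bsub>?M\<^esub> = A"
  proof
    fix ik :: "nat \<times> nat"
    obtain i k where ik: "ik = (i, k)" by (cases ik)
    show "(A \<otimes>\<^bsub>?M\<^esub> \<one>\<^bsub>?M\<^esub>) ik = A ik"
    proof (cases "i < n \<and> k < n")
      case True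
      then have "(A \<otimes>\<^bsub>?M\<^esub> \<one>\<^bsub>?M\<^esub>) ik = (\<Oplus>j\<in>{..<n}. if j = k then A (i, j) else \<zero>)"
        using closed by (auto simp: matrix_ring_simps ik intro!: finsum_cong')
      also have "\<dots> = A ik"
        unfolding ik using True closed by (intro finsum_delta) auto
      finally show ?thesis .
    qed (auto simp: matrix_ring_simps ik ext)
  qed
qed

lemma monomial_matrix_closed:
  assumes "\<And>i. i < n \<Longrightarrow> d i \<in> carrier R"
  shows "monomial_matrix n R \<pi> d \<in> carrier (matrix_ring n R)"
  using assms by (auto simp: matrix_ring_simps monomial_matrix_def)

text \<open>In row i only the summand j = \<open>\<pi> i\<close> survives.\<close>

lemma monomial_matrix_mult:
  assumes d: "\<And>i. i < n \<Longrightarrow> d i \<in> carrier R" and e: "\<And>i. i < n \<Longrightarrow> e i \<in> carrier R"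
    and \<pi>: "\<And>i. i < n \<Longrightarrow> \<pi> i < n"
  shows "monomial_matrix n R \<pi> d \<otimes>\<^bsub>matrix_ring n R\<^esub> monomial_matrix n R \<rho> e
    = monomial_matrix n R (\<lambda>i. \<rho> (\<pi> i)) (\<lambda>i. d i \<otimes> e (\<pi> i))"
proof
  fix ik :: "nat \<times> nat"
  obtain i k where ik: "ik = (i, k)" by (cases ik)
  show "(monomial_matrix n R \<pi> d \<otimes>\<^bsub>matrix_ring n R\<^esub> monomial_matrix n R \<rho> e) ik
    = monomial_matrix n R (\<lambda>i. \<rho> (\<pi> i)) (\<lambda>i. d i \<otimes> e (\<pi> i)) ik"
  proof (cases "i < n \<and> k < n")
    case True
    then have "(monomial_matrix n R \<pi> d \<otimes>\<^bsub>matrix_ring n R\<^esub> monomial_matrix n R \<rho> e) ik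
      = (\<Oplus>j\<in>{..<n}. if j = \<pi> i then (if k = \<rho> j then d i \<otimes> e j else \<zero>) else \<zero>)"
      using d e by (auto simp: matrix_ring_simps ik monomial_matrix_def intro!: finsum_cong')
    also have "\<dots> = (if k = \<rho> (\<pi> i) then d i \<otimes> e (\<pi> i) else \<zero>)"
      using True d e \<pi> by (intro finsum_delta) auto
    also have "\<dots> = monomial_matrix n R (\<lambda>i. \<rho> (\<pi> i)) (\<lambda>i. d i \<otimes> e (\<pi> i)) ik"
      using True by (simp add: ik monomial_matrix_def)
    finally show ?thesis .
  qed (auto simp: matrix_ring_simps ik monomial_matrix_def)
qed

lemma monomial_matrix_one: "\<one>\<^bsub>matrix_ring n R\<^esub> = monomial_matrix n R id (\<lambda>_. \<one>)"
  by (auto simp: matrix_ring_simps monomial_matrix_def)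

lemma diag_matrix_monomial: "diag_matrix R ds = monomial_matrix (length ds) R id (\<lambda>i. ds ! i)"
  by (auto simp: diag_matrix_def monomial_matrix_def intro!: restrict_ext)

lemma monomial_matrix_cong:
  "(\<And>i. i < n \<Longrightarrow> \<pi> i = \<rho> i) \<Longrightarrow> (\<And>i. i < n \<Longrightarrow> d i = e i) \<Longrightarrow>
    monomial_matrix n R \<pi> d = monomial_matrix n R \<rho> e"
  by (auto simp: monomial_matrix_def intro!: restrict_ext)

end

section \<open>Conjugates and extensions of subgroups\<close>

context group
begin

lemma subgroup_conj:
  assumes K: "subgroup K G" and x: "x \<in> carrier G"
  shows "subgroup ((\<lambda>k. inv x \<otimes> k \<otimes> x) ` K) G"
proof (rule subgroupI)
  interpret K: subgroup K G by (rule K)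
  show "(\<lambda>k. inv x \<otimes> k \<otimes> x) ` K \<subseteq> carrier G" using x by auto
  show "(\<lambda>k. inv x \<otimes> k \<otimes> x) ` K \<noteq> {}" using K.one_closed by blast
next
  interpret K: subgroup K G by (rule K)
  fix a assume "a \<in> (\<lambda>k. inv x \<otimes> k \<otimes> x) ` K"
  then obtain k where k: "k \<in> K" "a = inv x \<otimes> k \<otimes> x" by blast
  then have "inv a = inv x \<otimes> inv k \<otimes> x"
    using x by (simp add: inv_mult_group m_assoc)
  then show "inv a \<in> (\<lambda>k. inv x \<otimes> k \<otimes> x) ` K" using k by blast
  fix b assume "b \<in> (\<lambda>k. inv x \<otimes> k \<otimes> x) ` K"
  then obtain l where l: "l \<in> K" "b = inv x \<otimes> l \<otimes> x" by blast
  have "a \<otimes> b = inv x \<otimes> k \<otimes> (x \<otimes> inv x) \<otimes> l \<otimes> x"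
    unfolding k(2) l(2) using K.mem_carrier[OF k(1)] K.mem_carrier[OF l(1)] x
    by (simp only: m_assoc inv_closed m_closed)
  also have "\<dots> = inv x \<otimes> (k \<otimes> l) \<otimes> x"
    using k l x by (simp add: m_assoc)
  finally show "a \<otimes> b \<in> (\<lambda>k. inv x \<otimes> k \<otimes> x) ` K" using k l by blast
qed

text \<open>Conjugating K back gives a finite group above H, hence H itself: maximality passes to
  conjugates.\<close>

lemma maximal_finite_subgroup_conj:
  assumes H: "maximal_finite_subgroup H G" and HL: "conjugate_subgroups G H L"
    and K: "subgroup K G" "finite K" "L \<subseteq> K"
  shows "K = L"
proof -
  obtain x where x: "x \<in> carrier G" and L: "L = x <# (H #> inv x)"
    using HL unfolding conjugate_subgroups_def by blast
  have L': "L = (\<lambda>h. x \<otimes> (h \<otimes> inv x)) ` H"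
    unfolding L l_coset_def r_coset_def by auto
  have Hc: "H \<subseteq> carrier G"
    using H subgroup.subset unfolding maximal_finite_subgroup_def by blast
  let ?c = "\<lambda>k. inv x \<otimes> k \<otimes> x"
  have "?c (x \<otimes> (h \<otimes> inv x)) = h" if "h \<in> H" for h
  proof -
    have h: "h \<in> carrier G" using that Hc by blast
    then have "?c (x \<otimes> (h \<otimes> inv x)) = (inv x \<otimes> x) \<otimes> h \<otimes> (inv x \<otimes> x)"
      using x by (simp only: m_assoc inv_closed m_closed)
    then show ?thesis using x h by simp
  qed
  then have "h \<in> ?c ` L" if "h \<in> H" for h
    using that unfolding L' by (metis imageI)
  then have "H \<subseteq> ?c ` K" using K(3) by blast
  moreover have "finite (?c ` K)" using K(2) by simp
  ultimately have cK: "?c ` K = H"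
    using H subgroup_conj[OF K(1) x] unfolding maximal_finite_subgroup_def by blast
  have "k \<in> L" if "k \<in> K" for k
  proof -
    have k: "k \<in> carrier G" using that subgroup.mem_carrier[OF K(1)] by blast
    have "x \<otimes> (?c k \<otimes> inv x) = (x \<otimes> inv x) \<otimes> k \<otimes> (x \<otimes> inv x)"
      using x k by (simp only: m_assoc inv_closed m_closed)
    then have "x \<otimes> (?c k \<otimes> inv x) = k" using x k by simp
    moreover have "?c k \<in> H" using cK that by blast
    ultimately show ?thesis unfolding L' by (metis imageI)
  qed
  with K(3) show ?thesis by blast
qed

text \<open>Since h t = t (t h t) with t h t in H, all products fold into the two cosets H and t
  H.\<close>

lemma subgroup_adjoin_involution:
  assumes H: "subgroup H G" and t: "t \<in> carrier G" "t \<otimes> t = \<one>"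
    and norm: "\<And>h. h \<in> H \<Longrightarrow> t \<otimes> h \<otimes> t \<in> H"
  shows "subgroup (H \<union> (\<lambda>h. t \<otimes> h) ` H) G"
proof (rule subgroupI)
  interpret H: subgroup H G by (rule H)
  let ?K = "H \<union> (\<lambda>h. t \<otimes> h) ` H"
  show "?K \<subseteq> carrier G" using t by auto
  show "?K \<noteq> {}" using H.one_closed by blast
  have tt: "t \<otimes> (t \<otimes> x) = x" if "x \<in> carrier G" for x
    using t that by (simp flip: m_assoc)
  have swap: "h \<otimes> (t \<otimes> x) = t \<otimes> (t \<otimes> h \<otimes> t \<otimes> x)" if "h \<in> H" "x \<in> carrier G" for h x
    using that t tt by (simp add: m_assoc)
  have invt: "inv t = t" using t by (simp add: inv_equality)
  fix a assume a: "a \<in> ?K"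
  then show "inv a \<in> ?K"
  proof
    assume "a \<in> (\<lambda>h. t \<otimes> h) ` H"
    then obtain h where h: "h \<in> H" "a = t \<otimes> h" by blast
    then have "inv a = t \<otimes> (t \<otimes> inv h \<otimes> t)"
      using t tt by (simp add: inv_mult_group invt m_assoc)
    then show ?thesis using norm[of "inv h"] h by blast
  qed simp
  fix b assume b: "b \<in> ?K"
  from a b consider "a \<in> H" "b \<in> H" | k where "a \<in> H" "k \<in> H" "b = t \<otimes> k"
    | h where "h \<in> H" "a = t \<otimes> h" "b \<in> H"
    | h k where "h \<in> H" "a = t \<otimes> h" "k \<in> H" "b = t \<otimes> k"
    by blast
  then show "a \<otimes> b \<in> ?K"
  proof cases
    case 1
    then show ?thesis by simp
  next
    case (2 k)
    then have "a \<otimes> b = t \<otimes> (t \<otimes> a \<otimes> t \<otimes> k)" using swap by simp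
    moreover have "t \<otimes> a \<otimes> t \<otimes> k \<in> H" using norm 2 by blast
    ultimately show ?thesis by blast
  next
    case (3 h)
    then have "a \<otimes> b = t \<otimes> (h \<otimes> b)" using t by (simp add: m_assoc)
    then show ?thesis using 3 by blast
  next
    case (4 h k)
    then have "a \<otimes> b = t \<otimes> h \<otimes> t \<otimes> k" using t by (simp add: m_assoc)
    then show ?thesis using norm 4 by auto
  qed
qed

end

text \<open>Addressing the blocks by position allows all pairs of blocks to be treated at
  once.\<close>

lemma (in ring) Diag_monomial:
  "Diag R G1 G2 G3 = {monomial_matrix 3 R id d | d. \<forall>k<3. d k \<in> [G1, G2, G3] ! k}"
proof (intro Set.set_eqI iffI)
  fix A assume "A \<in> Diag R G1 G2 G3"
  then obtain g1 g2 g3 where g: "g1 \<in> G1" "g2 \<in> G2" "g3 \<in> G3" and A: "A = diag_matrix R [g1, g2, g3]"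
    unfolding Diag_def by blast
  have "A = monomial_matrix 3 R id (\<lambda>i. [g1, g2, g3] ! i)"
    unfolding A diag_matrix_monomial by (simp add: numeral_3_eq_3)
  moreover have "\<forall>k<3. [g1, g2, g3] ! k \<in> [G1, G2, G3] ! k"
    using g by (auto simp: numeral_3_eq_3 less_Suc_eq)
  ultimately show "A \<in> {monomial_matrix 3 R id d | d. \<forall>k<3. d k \<in> [G1, G2, G3] ! k}" by blast
next
  fix A assume "A \<in> {monomial_matrix 3 R id d | d. \<forall>k<3. d k \<in> [G1, G2, G3] ! k}"
  then obtain d where d: "\<forall>k<3. d k \<in> [G1, G2, G3] ! k" and A: "A = monomial_matrix 3 R id d" by blast
  have "A = diag_matrix R [d 0, d 1, d 2]"
    unfolding A diag_matrix_monomial by (auto simp: numeral_3_eq_3 numeral_2_eq_2 less_Suc_eq intro!: monomial_matrix_cong)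
  moreover have "d 0 \<in> G1" "d 1 \<in> G2" "d 2 \<in> G3"
    using d[rule_format, of 0] d[rule_format, of 1] d[rule_format, of 2] by simp_all
  ultimately show "A \<in> Diag R G1 G2 G3" unfolding Diag_def by blast
qed

text \<open>
  A monomial matrix swapping the two conjugate blocks normalizes the diagonal group without
  belonging to it.
\<close>

lemma Diag_not_conj_maximal:
  fixes D (structure)
  assumes "ring D" and nontriv: "\<one> \<noteq> \<zero>"
    and ij: "i < 3" "j < 3" "i \<noteq> j" and conj: "conj_by_unit D ([G1, G2, G3] ! i) ([G1, G2, G3] ! j)"
    and units: "G1 \<subseteq> Units D" "G2 \<subseteq> Units D" "G3 \<subseteq> Units D"
    and G: "maximal_finite_subgroup G (GL 3 D)" and GH: "conjugate_subgroups (GL 3 D) G (Diag D G1 G2 G3)"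
  shows False
proof -
  interpret D: ring D by fact
  let ?M = "matrix_ring 3 D" and ?H = "Diag D G1 G2 G3" and ?GG = "\<lambda>k. [G1, G2, G3] ! k"
  interpret M: monoid ?M by (rule D.matrix_ring_monoid)
  interpret GL: group "GL 3 D" unfolding GL_def by (rule M.units_group)
  have GLs: "carrier (GL 3 D) = Units ?M" "\<And>A B. A \<otimes>\<^bsub>GL 3 D\<^esub> B = A \<otimes>\<^bsub>?M\<^esub> B" "\<one>\<^bsub>GL 3 D\<^esub> = \<one>\<^bsub>?M\<^esub>"
    by (simp_all add: GL_def units_of_def)
  obtain u where u: "u \<in> Units D" and Gj: "?GG j = (\<lambda>x. u \<otimes> x \<otimes> inv u) ` ?GG i"
    using conj unfolding conj_by_unit_def by blast
  have uc: "u \<in> carrier D" "inv u \<in> carrier D" "u \<otimes> inv u = \<one>" "inv u \<otimes> u = \<one>"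
    using u by (simp_all add: D.Units_closed)
  \<comment> \<open>Conjugating by t replaces block i by inv u (d j) u and block j by u (d i) (inv
    u), which suits block group j being the conjugate of block group i by u. The entries inv u and u
    cancel in t t.\<close>
  define s where "s k = (if k = i then j else if k = j then i else k)" for k
  define c where "c k = (if k = i then inv u else if k = j then u else \<one>)" for k
  define t where "t = monomial_matrix 3 D s c"
  have s: "s k < 3" if "k < 3" for k using that ij by (simp add: s_def)
  have ss: "s (s k) = k" for k using ij by (simp add: s_def)
  have c: "c k \<in> carrier D" for k using uc by (simp add: c_def)
  have cc: "c k \<otimes> c (s k) = \<one>" for k using uc ij by (auto simp: c_def s_def)
  have units': "?GG k \<subseteq> carrier D" if "k < 3" for k
    using that units D.Units_closed by (auto simp: numeral_3_eq_3 less_Suc_eq)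
  have tM: "t \<in> carrier ?M" unfolding t_def using c by (intro D.monomial_matrix_closed)
  have tt: "t \<otimes>\<^bsub>?M\<^esub> t = \<one>\<^bsub>?M\<^esub>"
    unfolding t_def D.monomial_matrix_one
    using c s by (subst D.monomial_matrix_mult) (auto simp: ss cc intro!: D.monomial_matrix_cong)
  have tGL: "t \<in> carrier (GL 3 D)"
    using tM tt unfolding GLs Units_def by blast
  have norm: "t \<otimes>\<^bsub>?M\<^esub> h \<otimes>\<^bsub>?M\<^esub> t \<in> ?H" if hH: "h \<in> ?H" for h
  proof -
    obtain d where d': "\<forall>k<3. d k \<in> ?GG k" and h: "h = monomial_matrix 3 D id d"
      using hH unfolding D.Diag_monomial by blast
    have d: "d k \<in> ?GG k" if "k < 3" for k using d' that by blast
    have dc: "d k \<in> carrier D" if "k < 3" for k using d[OF that] units'[OF that] by blast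
    have "t \<otimes>\<^bsub>?M\<^esub> h = monomial_matrix 3 D s (\<lambda>k. c k \<otimes> d (s k))"
      unfolding t_def h using c s dc by (subst D.monomial_matrix_mult) auto
    then have "t \<otimes>\<^bsub>?M\<^esub> h \<otimes>\<^bsub>?M\<^esub> t = monomial_matrix 3 D (\<lambda>k. s (s k)) (\<lambda>k. c k \<otimes> d (s k) \<otimes> c (s k))"
      unfolding t_def using c s dc by (subst D.monomial_matrix_mult[symmetric]) auto
    then have eq: "t \<otimes>\<^bsub>?M\<^esub> h \<otimes>\<^bsub>?M\<^esub> t = monomial_matrix 3 D id (\<lambda>k. c k \<otimes> d (s k) \<otimes> c (s k))"
      by (simp add: ss id_def)
    have "c k \<otimes> d (s k) \<otimes> c (s k) \<in> ?GG k" if k: "k < 3" for k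
    proof -
      consider "k = i" | "k = j" | "k \<noteq> i" "k \<noteq> j" by blast
      then show ?thesis
      proof cases
        case 1
        obtain g where g: "g \<in> ?GG i" "d j = u \<otimes> g \<otimes> inv u"
          using d[OF ij(2)] unfolding Gj by blast
        have gc: "g \<in> carrier D" using g(1) units'[OF ij(1)] by blast
        have "inv u \<otimes> (u \<otimes> g \<otimes> inv u) \<otimes> u = (inv u \<otimes> u) \<otimes> g \<otimes> (inv u \<otimes> u)"
          using uc(1,2) gc by (simp only: D.m_assoc D.m_closed)
        also have "\<dots> = g" using uc gc by simp
        finally show ?thesis using 1 g ij by (simp add: c_def s_def)
      next
        case 2
        then show ?thesis using d[OF ij(1)] Gj ij(3) by (simp add: c_def s_def)
      next
        case 3
        then show ?thesis using d[OF k] dc[OF k] by (simp add: c_def s_def)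
      qed
    qed
    then show ?thesis unfolding eq D.Diag_monomial by blast
  qed
  have H: "subgroup ?H (GL 3 D)" "finite ?H"
  proof -
    obtain x where x: "x \<in> carrier (GL 3 D)" and L: "?H = x <#\<^bsub>GL 3 D\<^esub> (G #>\<^bsub>GL 3 D\<^esub> inv\<^bsub>GL 3 D\<^esub> x)"
      using GH unfolding conjugate_subgroups_def by blast
    have G': "subgroup G (GL 3 D)" "finite G" using G unfolding maximal_finite_subgroup_def by auto
    have "?H = (\<lambda>h. inv\<^bsub>GL 3 D\<^esub> (inv\<^bsub>GL 3 D\<^esub> x) \<otimes>\<^bsub>GL 3 D\<^esub> h \<otimes>\<^bsub>GL 3 D\<^esub> inv\<^bsub>GL 3 D\<^esub> x) ` G"
      unfolding L l_coset_def r_coset_def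
      using x subgroup.mem_carrier[OF G'(1)] by (auto simp: GL.m_assoc)
    then show "subgroup ?H (GL 3 D)" "finite ?H"
      using GL.subgroup_conj[OF G'(1), of "inv\<^bsub>GL 3 D\<^esub> x"] x G'(2) by simp_all
  qed
  let ?K = "?H \<union> (\<lambda>h. t \<otimes>\<^bsub>GL 3 D\<^esub> h) ` ?H"
  have "subgroup ?K (GL 3 D)"
    using tt norm by (intro GL.subgroup_adjoin_involution[OF H(1) tGL]) (simp_all add: GLs)
  moreover have "finite ?K" using H(2) by simp
  ultimately have "?K = ?H"
    by (intro GL.maximal_finite_subgroup_conj[OF G GH]) auto
  moreover have "t \<in> ?K"
  proof -
    have "t = t \<otimes>\<^bsub>GL 3 D\<^esub> \<one>\<^bsub>GL 3 D\<^esub>" using tGL by simp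
    then show ?thesis using subgroup.one_closed[OF H(1)] by blast
  qed
  ultimately obtain d where "t = monomial_matrix 3 D id d"
    unfolding D.Diag_monomial by blast
  \<comment> \<open>The entry at (i, j) is off the diagonal, but in t it is the unit inv u.\<close>
  then have "t (i, j) = \<zero>" using ij by (simp add: monomial_matrix_def)
  then have "inv u = \<zero>" using ij by (simp add: t_def monomial_matrix_def s_def c_def)
  then show False using uc nontriv by simp
qed

text \<open>In the zero ring the image of the embedding would be a single point, yet it contains
  both 0 and 1.\<close>

lemma ramified_at_infinity_nontrivial:
  assumes "ring D" "ramified_at abs_infinity D"
  shows "\<one>\<^bsub>D\<^esub> \<noteq> \<zero>\<^bsub>D\<^esub>"
proof
  interpret D: ring D by fact
  assume "\<one>\<^bsub>D\<^esub> = \<zero>\<^bsub>D\<^esub>"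
  then have triv: "carrier D = {\<zero>\<^bsub>D\<^esub>}" by (rule D.one_zeroD)
  obtain \<phi> :: "'a \<Rightarrow> quat" where "rat_quat_algebra (\<phi> ` carrier D)"
    using definite_quaternion_embedding[OF assms(2)] by blast
  then interpret S: rat_quat_algebra "\<phi> ` carrier D" .
  show False using S.one_mem S.zero_mem triv by auto
qed

theorem theorem5p15:
  fixes p :: nat and D :: "('d, 'm) ring_scheme"
  assumes "Factorial_Ring.prime p"
    and "is_D_p_infinity p D"
  shows "\<not> (\<exists>G G1 G2 G3.
    maximal_finite_subgroup G (GL 3 D) \<and> reducible_in (matrix_ring 3 D) G \<and>
    (\<forall>H\<in>{G1, G2, G3}. maximal_finite_subgroup H (units_of D) \<and> irreducible_in D H) \<and>
    conjugate_subgroups (GL 3 D) G (Diag D G1 G2 G3))"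
proof (rule notI, elim exE conjE)
  fix G G1 G2 G3
  assume G: "maximal_finite_subgroup G (GL 3 D)"
    and max: "\<forall>H\<in>{G1, G2, G3}. maximal_finite_subgroup H (units_of D) \<and> irreducible_in D H"
    and conj: "conjugate_subgroups (GL 3 D) G (Diag D G1 G2 G3)"
  have D: "ring D" and ram: "ramified_at abs_infinity D"
    using assms(2) by (simp_all add: is_D_p_infinity_def rat_quaternion_algebra_def)
  have units: "H \<subseteq> Units D" if "maximal_finite_subgroup H (units_of D)" for H
    using that subgroup.subset unfolding maximal_finite_subgroup_def by (fastforce simp: units_of_carrier)
  have no: False if "i < 3" "j < 3" "i \<noteq> j" "conj_by_unit D ([G1, G2, G3] ! i) ([G1, G2, G3] ! j)" for i j
    using Diag_not_conj_maximal[OF D ramified_at_infinity_nontrivial[OF D ram] that _ _ _ G conj] units max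
    by blast
  have "conj_by_unit D G1 G2 \<or> conj_by_unit D G1 G3 \<or> conj_by_unit D G2 G3"
    using two_of_three_conj_units[OF D ram] max by blast
  then show False
    using no[of 0 1] no[of 0 2] no[of 1 2] by auto
qed

end
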